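(* Let a one-period robust large financial market $(\Omega^n,\mathcal{F}^n,\mathcal{P}^n,S^n)_{n\ge1}$ be given such that, for every $n\ge1$, $l(\mathbb{L}^\infty(\mathcal{P}^n))=E_n'$ and the no-arbitrage condition NA$(\mathcal{P}^n)$ holds. Then the following are equivalent: (1) NAA1$(\mathcal{P}^n)$ holds, i.e. there is no asymptotic arbitrage of first kind; (2) for each sequence $(P^n)_{n\ge1}$ with $P^n\in\mathcal{P}^n$ for all $n$, there exists a sequence $(Q^n)_{n\ge1}$ with $Q^n\in\mathcal{Q}^n$ for all $n$ such that $(P^n)_{n\ge1}\triangleleft(Q^n)_{n\ge1}$.
   Context: Market: for each $n\ge1$, $(\Omega^n,\mathcal{F}^n)$ is a measurable space, $\mathcal{P}^n$ is a non-empty convex set of probability measures on it, $d(n)\in\mathbb{N}$, $S^n_0\in\mathbb{R}^{d(n)}$ is deterministic and $S^n_1$ is an $\mathcal{F}^n$-measurable $\mathbb{R}^{d(n)}$-valued random vector (discounted prices at times $0$ and $1$). A trading strategy is a deterministic vector $H^n\in\mathbb{R}^{d(n)}$; its portfolio has terminal value $X^n_1=H^n(S^n_1-S^n_0):=\sum_{i=1}^{d(n)}H^{n,i}(S^{n,i}_1-S^{n,i}_0)$. Quasi-sure notions: a set is $\mathcal{P}^n$-polar if it is contained in some $A\in\mathcal{F}^n$ with $P(A)=0$ for all $P\in\mathcal{P}^n$; a property holds $\mathcal{P}^n$-q.s. if it holds outside a $\mathcal{P}^n$-polar set. NA$(\mathcal{P}^n)$: for all $H^n\in\mathbb{R}^{d(n)}$,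 $H^n(S^n_1-S^n_0)\ge0$ $\mathcal{P}^n$-q.s. implies $H^n(S^n_1-S^n_0)=0$ $\mathcal{P}^n$-q.s. Duality condition: $\mathbb{L}^\infty(\mathcal{P}^n)$ is the space of real $\mathcal{F}^n$-measurable functions bounded by a constant $\mathcal{P}^n$-q.s., modulo $\mathcal{P}^n$-q.s. equality, with norm $\inf\{M\ge0:|X|\le M\ \mathcal{P}^n\text{-q.s.}\}$. $E_n$ is the space of finite signed measures on $\mathcal{F}^n$ absolutely continuous with respect to at least one $P\in\mathcal{P}^n$, with the total variation norm, and $E_n'$ its dual. $l:\mathbb{L}^\infty(\mathcal{P}^n)\to E_n'$ is given by $l(h)(\mu)=\int h\,d\mu$; $l(\mathbb{L}^\infty(\mathcal{P}^n))$ is its image. Martingale measures: $\mathcal{Q}^n$ is the set of probability measures $Q$ on $(\Omega^n,\mathcal{F}^n)$ such that $Q\ll P$ for some $P\in\mathcal{P}^n$ and $E_Q[S^{n,i}_1-S^{n,i}_0]=0$ for $i=1,\dots,d(n)$, where $E_Q[f]=E_Q[f^+]-E_Q[f^-]$ with the convention $\infty-\infty=-\infty$. Asymptotic arbitrage of first kind, AA1$(\mathcal{P}^n)$: there exist a subsequence of markets $n_k$, portfolios $X^k_1=H^{n_k}(S^{n_k}_1-S^{n_k}_0)$ with $H^{n_k}\in\mathbb{R}^{d(n_k)}$, and positive reals $c_k\to0$ such that (i) for all $k\ge1$, $X^k_1\ge-c_k$ $\mathcal{P}^{n_k}$-q.s., and (ii) there exist $\alpha>0$ and $P^k\in\mathcal{P}^{n_k}$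 with $P^k(X^k_1\ge\alpha)\ge\alpha$ for all $k\ge1$. NAA1$(\mathcal{P}^n)$ means no AA1$(\mathcal{P}^n)$ exists. Contiguity: $(P^n)_{n\ge1}\triangleleft(Q^n)_{n\ge1}$ means that for every sequence $A^n\in\mathcal{F}^n$ with $Q^n(A^n)\to0$ we have $P^n(A^n)\to0$. *)

theory Defs
  imports "HOL-Probability.Probability"
begin

(* A measurable space is represented by a measure M of which only space M and sets M are used;
   the measure values of M play no role.  Points of all the spaces live in one type 'a, but the
   sample space is space M, so a sequence of markets may have arbitrary different sample spaces. *)

definition polar :: "'a measure \<Rightarrow> 'a measure set \<Rightarrow> 'a set \<Rightarrow> bool" where
  "polar M \<P> N \<longleftrightarrow> (\<exists>A\<in>sets M. N \<subseteq> A \<and> (\<forall>P\<in>\<P>. emeasure P A = 0))"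

definition qs :: "'a measure \<Rightarrow> 'a measure set \<Rightarrow> ('a \<Rightarrow> bool) \<Rightarrow> bool" where
  "qs M \<P> \<phi> \<longleftrightarrow> polar M \<P> {\<omega> \<in> space M. \<not> \<phi> \<omega>}"

(* A vector in R^d is a function on nat of which only the values at 1, ..., d are used.  The time-0
   prices S0 are an arbitrary such vector, on which there is nothing to assume. *)
locale robust_market =
  fixes M :: "'a measure" and \<P> :: "'a measure set" and d :: nat
    and S1 :: "nat \<Rightarrow> 'a \<Rightarrow> real"
  assumes prior: "P \<in> \<P> \<Longrightarrow> prob_space P \<and> sets P = sets M"
    and nonempty: "\<P> \<noteq> {}"
    and convex: "\<lbrakk>P \<in> \<P>; P' \<in> \<P>; 0 \<le> t; t \<le> 1\<rbrakk> \<Longrightarrow>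
      \<exists>R\<in>\<P>. \<forall>A\<in>sets M. measure R A = t * measure P A + (1 - t) * measure P' A"
    and measurable_S1: "i \<in> {1..d} \<Longrightarrow> S1 i \<in> borel_measurable M"

definition gain :: "nat \<Rightarrow> (nat \<Rightarrow> real) \<Rightarrow> (nat \<Rightarrow> 'a \<Rightarrow> real) \<Rightarrow> (nat \<Rightarrow> real) \<Rightarrow> 'a \<Rightarrow> real" where
  "gain d S0 S1 H \<omega> = (\<Sum>i=1..d. H i * (S1 i \<omega> - S0 i))"

definition NA :: "'a measure \<Rightarrow> 'a measure set \<Rightarrow> nat \<Rightarrow> (nat \<Rightarrow> real) \<Rightarrow> (nat \<Rightarrow> 'a \<Rightarrow> real) \<Rightarrow> bool" where
  "NA M \<P> d S0 S1 \<longleftrightarrow> (\<forall>H. qs M \<P> (\<lambda>\<omega>. gain d S0 S1 H \<omega> \<ge> 0) \<longrightarrow>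
                           qs M \<P> (\<lambda>\<omega>. gain d S0 S1 H \<omega> = 0))"

(* Set functions vanish outside the sigma-algebra, so that equality of functions is equality of
   signed measures, and pointwise linear combinations stay within the space. *)
definition signed_measure :: "'a measure \<Rightarrow> ('a set \<Rightarrow> real) \<Rightarrow> bool" where
  "signed_measure M \<mu> \<longleftrightarrow> (\<forall>A. A \<notin> sets M \<longrightarrow> \<mu> A = 0) \<and> \<mu> {} = 0 \<and>
     (\<forall>A. range A \<subseteq> sets M \<longrightarrow> disjoint_family A \<longrightarrow> (\<lambda>i::nat. \<mu> (A i)) sums \<mu> (\<Union>i. A i))"

definition tv_norm :: "'a measure \<Rightarrow> ('a set \<Rightarrow> real) \<Rightarrow> real" where
  "tv_norm M \<mu> = (SUP \<pi>\<in>{\<pi>. finite \<pi> \<and> \<pi> \<subseteq> sets M \<and> disjoint \<pi> \<and> \<Union>\<pi> = space M}. \<Sum>A\<in>\<pi>. \<bar>\<mu> A\<bar>)"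

(* Upper variation of the Jordan decomposition; the lower variation of \<mu> is that of -\<mu>. *)
definition pos_variation :: "'a measure \<Rightarrow> ('a set \<Rightarrow> real) \<Rightarrow> 'a measure" where
  "pos_variation M \<mu> =
     measure_of (space M) (sets M) (\<lambda>A. ennreal (SUP B\<in>{B \<in> sets M. B \<subseteq> A}. \<mu> B))"

definition signed_integral :: "'a measure \<Rightarrow> ('a set \<Rightarrow> real) \<Rightarrow> ('a \<Rightarrow> real) \<Rightarrow> real" where
  "signed_integral M \<mu> h =
     integral\<^sup>L (pos_variation M \<mu>) h - integral\<^sup>L (pos_variation M (\<lambda>A. - \<mu> A)) h"

definition E_space :: "'a measure \<Rightarrow> 'a measure set \<Rightarrow> ('a set \<Rightarrow> real) set" where
  "E_space M \<P> = {\<mu>. signed_measure M \<mu> \<and>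
     (\<exists>P\<in>\<P>. \<forall>A\<in>sets M. emeasure P A = 0 \<longrightarrow> \<mu> A = 0)}"

(* Bounded linear functionals on E_space, made extensional so that they are determined by their
   values on E_space. *)
definition E_dual :: "'a measure \<Rightarrow> 'a measure set \<Rightarrow> (('a set \<Rightarrow> real) \<Rightarrow> real) set" where
  "E_dual M \<P> = {\<phi> \<in> extensional (E_space M \<P>).
     (\<forall>\<mu>\<in>E_space M \<P>. \<forall>\<nu>\<in>E_space M \<P>. \<phi> (\<lambda>A. \<mu> A + \<nu> A) = \<phi> \<mu> + \<phi> \<nu>) \<and>
     (\<forall>c. \<forall>\<mu>\<in>E_space M \<P>. \<phi> (\<lambda>A. c * \<mu> A) = c * \<phi> \<mu>) \<and>
     (\<exists>C. \<forall>\<mu>\<in>E_space M \<P>. \<bar>\<phi> \<mu>\<bar> \<le> C * tv_norm M \<mu>)}"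

definition qs_bounded :: "'a measure \<Rightarrow> 'a measure set \<Rightarrow> ('a \<Rightarrow> real) set" where
  "qs_bounded M \<P> = {h \<in> borel_measurable M. \<exists>C. qs M \<P> (\<lambda>\<omega>. \<bar>h \<omega>\<bar> \<le> C)}"

definition qs_eq :: "'a measure \<Rightarrow> 'a measure set \<Rightarrow> (('a \<Rightarrow> real) \<times> ('a \<Rightarrow> real)) set" where
  "qs_eq M \<P> = {(f, g) \<in> qs_bounded M \<P> \<times> qs_bounded M \<P>. qs M \<P> (\<lambda>\<omega>. f \<omega> = g \<omega>)}"

definition Linfty :: "'a measure \<Rightarrow> 'a measure set \<Rightarrow> ('a \<Rightarrow> real) set set" where
  "Linfty M \<P> = qs_bounded M \<P> // qs_eq M \<P>"

(* The functional does not depend on the representative of the class X, so the image below is a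
   singleton. *)
definition l_map :: "'a measure \<Rightarrow> 'a measure set \<Rightarrow> ('a \<Rightarrow> real) set \<Rightarrow> (('a set \<Rightarrow> real) \<Rightarrow> real)" where
  "l_map M \<P> X = the_elem ((\<lambda>h. \<lambda>\<mu>\<in>E_space M \<P>. signed_integral M \<mu> h) ` X)"

(* E[f+] - E[f-] with the convention that infinity minus infinity is minus infinity (whereas in
   type ereal it is plus infinity). *)
definition gen_expectation :: "'a measure \<Rightarrow> ('a \<Rightarrow> real) \<Rightarrow> ereal" where
  "gen_expectation Q f =
     (let p = \<integral>\<^sup>+\<omega>. ennreal (max 0 (f \<omega>)) \<partial>Q; m = \<integral>\<^sup>+\<omega>. ennreal (max 0 (- f \<omega>)) \<partial>Q
      in if p = \<infinity> \<and> m = \<infinity> then - \<infinity> else enn2ereal p - enn2ereal m)"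

definition martingale_measures ::
  "'a measure \<Rightarrow> 'a measure set \<Rightarrow> nat \<Rightarrow> (nat \<Rightarrow> real) \<Rightarrow> (nat \<Rightarrow> 'a \<Rightarrow> real) \<Rightarrow> 'a measure set" where
  "martingale_measures M \<P> d S0 S1 = {Q. prob_space Q \<and> sets Q = sets M \<and>
     (\<exists>P\<in>\<P>. absolutely_continuous P Q) \<and>
     (\<forall>i\<in>{1..d}. gen_expectation Q (\<lambda>\<omega>. S1 i \<omega> - S0 i) = 0)}"

(* Sequences are indexed by the positive integers; their entry at 0 is ignored. *)
definition AA1 :: "(nat \<Rightarrow> 'a measure) \<Rightarrow> (nat \<Rightarrow> 'a measure set) \<Rightarrow> (nat \<Rightarrow> nat) \<Rightarrow>
    (nat \<Rightarrow> nat \<Rightarrow> real) \<Rightarrow> (nat \<Rightarrow> nat \<Rightarrow> 'a \<Rightarrow> real) \<Rightarrow> bool" where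
  "AA1 M \<P> d S0 S1 \<longleftrightarrow>
    (\<exists>(n :: nat \<Rightarrow> nat) (H :: nat \<Rightarrow> nat \<Rightarrow> real) (c :: nat \<Rightarrow> real).
       strict_mono_on {1..} n \<and> (\<forall>k\<ge>1. n k \<ge> 1) \<and> (\<forall>k\<ge>1. c k > 0) \<and> c \<longlonglongrightarrow> 0 \<and>
       (\<forall>k\<ge>1. qs (M (n k)) (\<P> (n k))
          (\<lambda>\<omega>. gain (d (n k)) (S0 (n k)) (S1 (n k)) (H k) \<omega> \<ge> - c k)) \<and>
       (\<exists>\<alpha>>0. \<exists>P. \<forall>k\<ge>1. P k \<in> \<P> (n k) \<and>
          measure (P k) {\<omega> \<in> space (M (n k)).
            gain (d (n k)) (S0 (n k)) (S1 (n k)) (H k) \<omega> \<ge> \<alpha>} \<ge> \<alpha>))"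

definition NAA1 :: "(nat \<Rightarrow> 'a measure) \<Rightarrow> (nat \<Rightarrow> 'a measure set) \<Rightarrow> (nat \<Rightarrow> nat) \<Rightarrow>
    (nat \<Rightarrow> nat \<Rightarrow> real) \<Rightarrow> (nat \<Rightarrow> nat \<Rightarrow> 'a \<Rightarrow> real) \<Rightarrow> bool" where
  "NAA1 M \<P> d S0 S1 \<longleftrightarrow> \<not> AA1 M \<P> d S0 S1"

definition contiguous ::
  "(nat \<Rightarrow> 'a measure) \<Rightarrow> (nat \<Rightarrow> 'a measure) \<Rightarrow> (nat \<Rightarrow> 'a measure) \<Rightarrow> bool" where
  "contiguous M P Q \<longleftrightarrow> (\<forall>A. (\<forall>n\<ge>1. A n \<in> sets (M n)) \<longrightarrow>
     (\<lambda>n. measure (Q n) (A n)) \<longlonglongrightarrow> 0 \<longrightarrow> (\<lambda>n. measure (P n) (A n)) \<longlonglongrightarrow> 0)"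

end

theory Submission
  imports Defs
begin

text \<open>
  Contiguity excludes asymptotic arbitrage because a gain bounded below by \<open>-c\<close> has mean 0 under a
  martingale measure, hence exceeds \<open>\<alpha>\<close> with probability at most \<open>c / \<alpha>\<close>.

  Conversely, absence of asymptotic arbitrage says that gains bounded below by \<open>-1\<close> are bounded in
  \<open>P n\<close>-probability, uniformly in large \<open>n\<close>.  In a fixed market, the strategies (modulo redundant ones)
  with gain at least \<open>-1\<close> quasi-surely form a bounded set by NA.  Minimise over a compact box the
  expectation under a prior \<open>R \<ge> P / 2\<close> of a loss consisting of \<open>ln (1 + exp (-X))\<close> and a multiple \<open>a\<close> of
  the squared shortfall of the gain \<open>X\<close> below \<open>-1\<close>.  By compactness, \<open>R\<close> and \<open>a\<close> can be chosen so
  that the minimiser is interior and has moderate gain with high \<open>P\<close>-probability.  The first-order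
  condition makes minus the derivative of the loss the density, up to a factor \<open>Z\<close>, of a martingale measure
  \<open>Q\<close>; the minimiser itself having mean 0 gives \<open>Z \<le> 1\<close>.  So \<open>Q\<close> dominates \<open>P\<close>, up to a small error, with a
  constant that only depends on the bound in probability.
\<close>

section \<open>Weighted integrals of gains and priors dominating compact sets of strategies\<close>

text \<open>Reweighting by this bounded factor makes squares of gains integrable under every prior; \<open>\<eta>\<close> is
  chosen so small that the factor exceeds 1/2 with probability close to 1.\<close>
definition tame_weight :: "nat \<Rightarrow> (nat \<Rightarrow> real) \<Rightarrow> (nat \<Rightarrow> 'a \<Rightarrow> real) \<Rightarrow> real \<Rightarrow> 'a \<Rightarrow> real" where
  "tame_weight d S0 S1 \<eta> \<omega> = 1 / (1 + \<eta> * (\<Sum>i=1..d. (S1 i \<omega> - S0 i)\<^sup>2))"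

lemma tame_weight_bounds:
  assumes "\<eta> > 0"
  shows "0 < tame_weight d S0 S1 \<eta> \<omega>" "tame_weight d S0 S1 \<eta> \<omega> \<le> 1"
    "tame_weight d S0 S1 \<eta> \<omega> * (\<Sum>i=1..d. (S1 i \<omega> - S0 i)\<^sup>2) \<le> 1 / \<eta>"
proof -
  define s where "s = (\<Sum>i=1..d. (S1 i \<omega> - S0 i)\<^sup>2)"
  have s: "s \<ge> 0" unfolding s_def by (intro sum_nonneg) auto
  have p: "1 + \<eta> * s > 0" using s assms by (simp add: add_pos_nonneg)
  have e: "tame_weight d S0 S1 \<eta> \<omega> = 1 / (1 + \<eta> * s)" by (simp add: tame_weight_def s_def)
  show "0 < tame_weight d S0 S1 \<eta> \<omega>" "tame_weight d S0 S1 \<eta> \<omega> \<le> 1"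
    using p s assms by (simp_all add: e)
  show "tame_weight d S0 S1 \<eta> \<omega> * (\<Sum>i=1..d. (S1 i \<omega> - S0 i)\<^sup>2) \<le> 1 / \<eta>"
    unfolding s_def[symmetric] e using p s assms by (simp add: field_simps)
qed

text \<open>Cauchy-Schwarz separates the strategy from the price increments, and the weight absorbs
  the sum of the squared increments.\<close>

lemma tame_weight_gain_sq:
  assumes "\<eta> > 0"
  shows "tame_weight d S0 S1 \<eta> \<omega> * (gain d S0 S1 H \<omega>)\<^sup>2 \<le> (\<Sum>i=1..d. (H i)\<^sup>2) / \<eta>"
proof -
  let ?w = "tame_weight d S0 S1 \<eta> \<omega>"
  have "?w * (gain d S0 S1 H \<omega>)\<^sup>2 \<le> ?w * ((\<Sum>i=1..d. (H i)\<^sup>2) * (\<Sum>i=1..d. (S1 i \<omega> - S0 i)\<^sup>2))"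
    unfolding gain_def using tame_weight_bounds(1)[OF assms, of d S0 S1 \<omega>]
    by (intro mult_left_mono Cauchy_Schwarz_ineq_sum) auto
  also have "\<dots> = (\<Sum>i=1..d. (H i)\<^sup>2) * (?w * (\<Sum>i=1..d. (S1 i \<omega> - S0 i)\<^sup>2))"
    by (simp add: mult_ac)
  also have "\<dots> \<le> (\<Sum>i=1..d. (H i)\<^sup>2) * (1 / \<eta>)"
    by (intro mult_left_mono tame_weight_bounds assms sum_nonneg) auto
  finally show ?thesis by simp
qed

text \<open>The weight absorbs the quadratic growth of \<open>f\<close>. The bound is free of
  \<omega> and depends on \<open>H\<close> only through its Euclidean norm, so it gives
  integrability and, along bounded sequences of strategies, a dominating constant.\<close>

lemma tame_weight_integrand_bound:
  fixes f :: "real \<Rightarrow> real"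
  assumes "\<eta> > 0" and f: "\<And>x. \<bar>f x\<bar> \<le> C * (1 + x\<^sup>2)"
  shows "\<bar>tame_weight d S0 S1 \<eta> \<omega> * f (gain d S0 S1 H \<omega>)\<bar> \<le> C * (1 + (\<Sum>i=1..d. (H i)\<^sup>2) / \<eta>)"
proof -
  let ?w = "tame_weight d S0 S1 \<eta> \<omega>" and ?X = "gain d S0 S1 H \<omega>"
  have C: "C \<ge> 0" using f[of 0] by simp
  note w = tame_weight_bounds[OF assms(1), of d S0 S1 \<omega>]
  have "\<bar>?w * f ?X\<bar> = ?w * \<bar>f ?X\<bar>" using w(1) by (simp add: abs_mult)
  also have "\<dots> \<le> ?w * (C * (1 + ?X\<^sup>2))" using w(1) f by (intro mult_left_mono) auto
  also have "\<dots> = C * (?w + ?w * ?X\<^sup>2)" by (simp add: algebra_simps)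
  also have "\<dots> \<le> C * (1 + (\<Sum>i=1..d. (H i)\<^sup>2) / \<eta>)"
    using w(2) tame_weight_gain_sq[OF assms(1), of d S0 S1 \<omega> H] C by (intro mult_left_mono add_mono) auto
  finally show ?thesis .
qed

lemma gain_add: "gain d S0 S1 (\<lambda>i. H i + G i) \<omega> = gain d S0 S1 H \<omega> + gain d S0 S1 G \<omega>"
  by (simp add: gain_def distrib_right sum.distrib)

lemma gain_scale: "gain d S0 S1 (\<lambda>i. c * H i) \<omega> = c * gain d S0 S1 H \<omega>"
  by (simp add: gain_def sum_distrib_left mult_ac)

lemma gain_unit:
  assumes "j \<in> {1..d}"
  shows "gain d S0 S1 (\<lambda>i. if i = j then 1 else 0) \<omega> = S1 j \<omega> - S0 j"
proof -
  have "(if i = j then 1 else 0) * (S1 i \<omega> - S0 i) = (if j = i then S1 i \<omega> - S0 i else 0)" for i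
    by auto
  thus ?thesis using assms by (simp add: gain_def sum.delta)
qed

lemma gain_zero: "gain d S0 S1 (\<lambda>i. 0) \<omega> = 0"
  by (simp add: gain_def)

context robust_market
begin

section \<open>Measurability and quasi-sure properties in one market\<close>

lemma space_prior: "P \<in> \<P> \<Longrightarrow> space P = space M"
  using prior sets_eq_imp_space_eq by blast

lemma measurable_gain [measurable]: "gain d S0 S1 H \<in> borel_measurable M"
proof -
  have [measurable]: "i \<in> {1..d} \<Longrightarrow> S1 i \<in> borel_measurable M" for i by (rule measurable_S1)
  show ?thesis unfolding gain_def[abs_def] by measurable
qed

lemma measurable_tame_weight [measurable]: "tame_weight d S0 S1 \<eta> \<in> borel_measurable M"
proof -
  have [measurable]: "i \<in> {1..d} \<Longrightarrow> S1 i \<in> borel_measurable M" for i by (rule measurable_S1)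
  show ?thesis unfolding tame_weight_def[abs_def] by measurable
qed

lemma qs_imp_AE:
  assumes "qs M \<P> \<phi>" "P \<in> \<P>"
  shows "AE \<omega> in P. \<phi> \<omega>"
proof -
  obtain A where A: "A \<in> sets M" "{\<omega> \<in> space M. \<not> \<phi> \<omega>} \<subseteq> A" "emeasure P A = 0"
    using assms unfolding qs_def polar_def by blast
  show ?thesis
    by (rule AE_I[of _ _ A]) (use A assms(2) in \<open>auto simp: space_prior prior\<close>)
qed

text \<open>The exceptional set of a measurable property is itself measurable, so this one set is
  null under every prior and witnesses polarity.\<close>

lemma qs_iff_AE:
  assumes [measurable]: "Measurable.pred M \<phi>"
  shows "qs M \<P> \<phi> \<longleftrightarrow> (\<forall>P\<in>\<P>. AE \<omega> in P. \<phi> \<omega>)"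
proof
  assume *: "\<forall>P\<in>\<P>. AE \<omega> in P. \<phi> \<omega>"
  have m: "{\<omega> \<in> space M. \<not> \<phi> \<omega>} \<in> sets M" by measurable
  have "emeasure P {\<omega> \<in> space M. \<not> \<phi> \<omega>} = 0" if P: "P \<in> \<P>" for P
    using * P m AE_iff_measurable[of _ P \<phi>] by (auto simp: space_prior prior)
  with m show "qs M \<P> \<phi>" unfolding qs_def polar_def by blast
qed (use qs_imp_AE in blast)

lemma integrable_tame_weight:
  assumes "prob_space R" "sets R = sets M" "\<eta> > 0"
    and [measurable]: "f \<in> borel_measurable borel" and f: "\<And>x. \<bar>f x\<bar> \<le> C * (1 + x\<^sup>2)"
  shows "integrable R (\<lambda>\<omega>. tame_weight d S0 S1 \<eta> \<omega> * f (gain d S0 S1 H \<omega>))"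
proof -
  interpret R: prob_space R by fact
  note [measurable_cong] = assms(2)
  show ?thesis
    by (rule R.integrable_const_bound[where B = "C * (1 + (\<Sum>i=1..d. (H i)\<^sup>2) / \<eta>)"])
      (use tame_weight_integrand_bound[OF assms(3) f] in \<open>auto simp del: One_nat_def intro!: AE_I2\<close>)
qed

text \<open>Dominated convergence along a convergent sequence of strategies, whose squared norms are
  bounded. Strategies carry the product topology, so convergence is coordinatewise.\<close>

lemma continuous_weighted_integral:
  assumes "prob_space R" "sets R = sets M" "\<eta> > 0"
    and cont: "continuous_on UNIV f" and f: "\<And>x. \<bar>f x\<bar> \<le> C * (1 + x\<^sup>2)"
  shows "continuous_on A (\<lambda>H. \<integral>\<omega>. tame_weight d S0 S1 \<eta> \<omega> * f (gain d S0 S1 H \<omega>) \<partial>R)"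
proof (rule continuous_on_sequentiallyI)
  fix H and h :: "nat \<Rightarrow> real" assume "H \<longlonglongrightarrow> h"
  interpret R: prob_space R by fact
  note [measurable_cong] = assms(2)
  have [measurable]: "f \<in> borel_measurable borel" using cont by (rule borel_measurable_continuous_onI)
  have coord: "(\<lambda>k. H k i) \<longlonglongrightarrow> h i" for i
    using continuous_on_tendsto_compose[OF continuous_on_product_coordinates \<open>H \<longlonglongrightarrow> h\<close>] by auto
  hence "(\<lambda>k. \<Sum>i=1..d. (H k i)\<^sup>2) \<longlonglongrightarrow> (\<Sum>i=1..d. (h i)\<^sup>2)" by (intro tendsto_intros)
  hence "Bseq (\<lambda>k. \<Sum>i=1..d. (H k i)\<^sup>2)" by (intro convergent_imp_Bseq convergentI)
  then obtain B where B: "\<And>k. (\<Sum>i=1..d. (H k i)\<^sup>2) \<le> B"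
    unfolding Bseq_def by (metis abs_le_D1 real_norm_def)
  have C: "C \<ge> 0" using f[of 0] by simp
  show "(\<lambda>k. \<integral>\<omega>. tame_weight d S0 S1 \<eta> \<omega> * f (gain d S0 S1 (H k) \<omega>) \<partial>R)
      \<longlonglongrightarrow> (\<integral>\<omega>. tame_weight d S0 S1 \<eta> \<omega> * f (gain d S0 S1 h \<omega>) \<partial>R)"
  proof (rule integral_dominated_convergence[where w = "\<lambda>_. C * (1 + B / \<eta>)"])
    show "AE \<omega> in R. (\<lambda>k. tame_weight d S0 S1 \<eta> \<omega> * f (gain d S0 S1 (H k) \<omega>))
        \<longlonglongrightarrow> tame_weight d S0 S1 \<eta> \<omega> * f (gain d S0 S1 h \<omega>)"
    proof (rule AE_I2)
      fix \<omega>
      have "(\<lambda>k. gain d S0 S1 (H k) \<omega>) \<longlonglongrightarrow> gain d S0 S1 h \<omega>"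
        unfolding gain_def by (intro tendsto_intros coord)
      from continuous_on_tendsto_compose[OF cont this]
      show "(\<lambda>k. tame_weight d S0 S1 \<eta> \<omega> * f (gain d S0 S1 (H k) \<omega>))
        \<longlonglongrightarrow> tame_weight d S0 S1 \<eta> \<omega> * f (gain d S0 S1 h \<omega>)"
        by (intro tendsto_intros) auto
    qed
    fix k
    have "C * (1 + (\<Sum>i=1..d. (H k i)\<^sup>2) / \<eta>) \<le> C * (1 + B / \<eta>)"
      using C B[of k] \<open>\<eta> > 0\<close> by (intro mult_left_mono add_left_mono divide_right_mono) auto
    thus "AE \<omega> in R. norm (tame_weight d S0 S1 \<eta> \<omega> * f (gain d S0 S1 (H k) \<omega>)) \<le> C * (1 + B / \<eta>)"
      using order.trans[OF tame_weight_integrand_bound[OF \<open>\<eta> > 0\<close> f]] by (auto intro!: AE_I2)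
  qed auto
qed

text \<open>Repeated averaging of two priors, allowed by convexity, dominates all of
  \<open>F\<close>. Averaging with \<open>P\<close> last keeps the factor 2 independent of the size
  of \<open>F\<close>.\<close>

lemma exists_dominating_prior:
  assumes "finite F" "F \<subseteq> \<P>" "P \<in> \<P>"
  shows "\<exists>R\<in>\<P>. (\<forall>A\<in>sets M. measure P A \<le> 2 * measure R A) \<and> (\<forall>P'\<in>F. absolutely_continuous R P')"
proof -
  have half: "\<exists>R\<in>\<P>. \<forall>A\<in>sets M. measure P A \<le> 2 * measure R A \<and> measure P' A \<le> 2 * measure R A"
    if PP': "P \<in> \<P>" "P' \<in> \<P>" for P P'
  proof -
    obtain R where "R \<in> \<P>" "\<forall>A\<in>sets M. measure R A = (1/2) * measure P A + (1 - 1/2) * measure P' A"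
      using convex[of P P' "1/2"] PP' by auto
    thus ?thesis by (intro bexI[of _ R]) auto
  qed
  have ac: "absolutely_continuous R P"
    if "R \<in> \<P>" "P \<in> \<P>" "\<forall>A\<in>sets M. measure P A \<le> 2 * measure R A" for R P
  proof -
    interpret R: prob_space R using prior that by blast
    interpret P: prob_space P using prior that by blast
    show ?thesis
      using that(3) prior[OF that(1)] prior[OF that(2)]
      by (auto simp: absolutely_continuous_def null_sets_def R.emeasure_eq_measure P.emeasure_eq_measure)
        (metis dual_order.antisym measure_nonneg mult_zero_right)
  qed
  have trans: "absolutely_continuous R P'"
    if "absolutely_continuous R P" "absolutely_continuous P P'" for R P P' :: "'a measure"
    using that by (auto simp: absolutely_continuous_def)
  have "\<exists>R\<in>\<P>. \<forall>P'\<in>F. absolutely_continuous R P'"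
    using assms(1,2)
  proof (induction F rule: finite_induct)
    case empty
    then show ?case using nonempty by auto
  next
    case (insert Q F)
    then obtain R where R: "R \<in> \<P>" "\<forall>P'\<in>F. absolutely_continuous R P'" by auto
    obtain R' where R': "R' \<in> \<P>"
      "\<forall>A\<in>sets M. measure R A \<le> 2 * measure R' A \<and> measure Q A \<le> 2 * measure R' A"
      using half[OF R(1), of Q] insert by auto
    have "absolutely_continuous R' R" "absolutely_continuous R' Q"
      using R' R insert.prems by (auto intro!: ac)
    with R R' show ?case by (intro bexI[of _ R']) (auto intro: trans)
  qed
  then obtain R where R: "R \<in> \<P>" "\<forall>P'\<in>F. absolutely_continuous R P'" by blast
  obtain R' where R': "R' \<in> \<P>"
    "\<forall>A\<in>sets M. measure P A \<le> 2 * measure R' A \<and> measure R A \<le> 2 * measure R' A"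
    using half[OF assms(3) R(1)] by auto
  have "absolutely_continuous R' R" using R' R by (auto intro!: ac)
  with R R' show ?thesis by (intro bexI[of _ R']) (auto intro: trans)
qed

text \<open>By compactness finitely many priors suffice to detect every strategy in \<open>T\<close>, and they can be mixed
  into one prior inside \<open>\<P>\<close>.  Keeping half of the mass on \<open>P\<close> is what later makes the constants uniform
  over the sequence of markets.\<close>
lemma exists_uniformly_charging_prior:
  assumes "compact T" "P \<in> \<P>" "\<eta> > 0"
    and cont: "continuous_on UNIV f" and f: "\<And>x. \<bar>f x\<bar> \<le> C * (1 + x\<^sup>2)" and nn: "\<And>x. f x \<ge> 0"
    and T: "\<And>H. H \<in> T \<Longrightarrow> \<not> qs M \<P> (\<lambda>\<omega>. f (gain d S0 S1 H \<omega>) = 0)"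
  shows "\<exists>R\<in>\<P>. (\<forall>A\<in>sets M. measure P A \<le> 2 * measure R A) \<and>
    (\<exists>s>0. \<forall>H\<in>T. s \<le> (\<integral>\<omega>. tame_weight d S0 S1 \<eta> \<omega> * f (gain d S0 S1 H \<omega>) \<partial>R))"
proof -
  let ?J = "\<lambda>P H. \<integral>\<omega>. tame_weight d S0 S1 \<eta> \<omega> * f (gain d S0 S1 H \<omega>) \<partial>P"
  have [measurable]: "f \<in> borel_measurable borel" using cont by (rule borel_measurable_continuous_onI)
  \<comment> \<open>The integrand is nonnegative and the weight never vanishes, so the integral is 0
    only if \<open>f\<close> of the gain is 0 almost surely.\<close>
  have J_pos: "?J P H > 0 \<longleftrightarrow> \<not> (AE \<omega> in P. f (gain d S0 S1 H \<omega>) = 0)" if P: "P \<in> \<P>" for P H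
  proof -
    have int: "integrable P (\<lambda>\<omega>. tame_weight d S0 S1 \<eta> \<omega> * f (gain d S0 S1 H \<omega>))"
      using prior[OF P] assms(3) f by (intro integrable_tame_weight) auto
    have w: "tame_weight d S0 S1 \<eta> \<omega> > 0" for \<omega> by (intro tame_weight_bounds assms)
    hence nn': "AE \<omega> in P. 0 \<le> tame_weight d S0 S1 \<eta> \<omega> * f (gain d S0 S1 H \<omega>)"
      using nn by (auto intro!: AE_I2 mult_nonneg_nonneg simp: less_imp_le)
    have "?J P H = 0 \<longleftrightarrow> (AE \<omega> in P. f (gain d S0 S1 H \<omega>) = 0)"
      using w by (subst integral_nonneg_eq_0_iff_AE[OF int nn']) (auto simp: less_le)
    moreover have "?J P H \<ge> 0" by (rule integral_nonneg_AE[OF nn'])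
    ultimately show ?thesis by linarith
  qed
  have J_cont: "continuous_on A (?J P)" if P: "P \<in> \<P>" for P A
    using prior[OF P] assms(3) cont f by (intro continuous_weighted_integral) auto
  have "T \<subseteq> (\<Union>P\<in>\<P>. {H. ?J P H > 0})"
    using T J_pos by (fastforce simp: qs_iff_AE)
  moreover have "open {H. ?J P H > 0}" if "P \<in> \<P>" for P
    using J_cont[OF that, of UNIV] by (intro open_Collect_less) auto
  ultimately obtain F where F: "F \<subseteq> \<P>" "finite F" "T \<subseteq> (\<Union>P\<in>F. {H. ?J P H > 0})"
    using compactE_image[OF \<open>compact T\<close>, of \<P> "\<lambda>P. {H. ?J P H > 0}"] by blast
  obtain R where R: "R \<in> \<P>" "\<forall>A\<in>sets M. measure P A \<le> 2 * measure R A"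
    "\<forall>P'\<in>F. absolutely_continuous R P'"
    using exists_dominating_prior[OF F(2,1) assms(2)] by blast
  \<comment> \<open>Some prior in \<open>F\<close> charges the strategy, and \<open>R\<close>
    dominates that prior, so it charges the strategy too.\<close>
  have pos: "?J R H > 0" if "H \<in> T" for H
  proof -
    obtain P' where P': "P' \<in> F" "?J P' H > 0" using F \<open>H \<in> T\<close> by auto
    have "\<not> (AE \<omega> in R. f (gain d S0 S1 H \<omega>) = 0)"
      using absolutely_continuous_AE[of P' R "\<lambda>\<omega>. f (gain d S0 S1 H \<omega>) = 0"] J_pos[of P'] P' R F(1)
        prior by (metis subsetD)
    thus ?thesis using J_pos R by blast
  qed
  have "\<exists>s>0. \<forall>H\<in>T. s \<le> ?J R H"
  proof (cases "T = {}")
    case False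
    then obtain H0 where "H0 \<in> T" "\<forall>H\<in>T. ?J R H0 \<le> ?J R H"
      using continuous_attains_inf[OF \<open>compact T\<close> _ J_cont[OF R(1)]] by blast
    with pos show ?thesis by blast
  qed (auto intro: exI[of _ 1])
  with R show ?thesis by blast
qed

end

section \<open>The loss function\<close>

definition softplus :: "real \<Rightarrow> real" where "softplus x = ln (1 + exp (- x))"
text \<open>Minus the derivative of \<open>softplus\<close>. With this sign it is the reflection at
  0 of the usual logistic function, hence decreasing.\<close>

definition logistic :: "real \<Rightarrow> real" where "logistic x = 1 / (1 + exp x)"
text \<open>The amount by which a gain falls below the admissibility level -1. Its square is
  continuously differentiable, with derivative \<open>- 2 * shortfall x\<close>.\<close>

definition shortfall :: "real \<Rightarrow> real" where "shortfall x = max 0 (- x - 1)"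

text \<open>The second derivative of \<open>softplus\<close> is at most 2, so the square function
  minus \<open>softplus\<close> is convex and lies above its tangents.\<close>

lemma softplus_upper: "softplus (x + h) \<le> softplus x - logistic x * h + h\<^sup>2"
proof -
  define G where "G x = x\<^sup>2 - softplus x" for x
  have nz: "1 + exp x \<noteq> 0" for x :: real by (metis add_pos_pos exp_gt_zero less_irrefl zero_less_one)
  have DG: "(G has_real_derivative 2 * x + logistic x) (at x)" for x
  proof -
    have "logistic x = exp (- x) / (1 + exp (- x))"
      using nz[of x] nz[of "- x"] by (simp add: logistic_def exp_minus field_simps)
    thus ?thesis
      unfolding G_def softplus_def by (auto intro!: derivative_eq_intros simp: add_pos_pos)
  qed
  have DG': "((\<lambda>x. 2 * x + logistic x) has_real_derivative 2 - exp x / (1 + exp x)\<^sup>2) (at x)" for x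
    unfolding logistic_def
    by (auto intro!: derivative_eq_intros simp: nz power2_eq_square)
  have "exp x / (1 + exp x)\<^sup>2 \<le> 2" for x :: real
  proof -
    have "exp x \<le> 2 * (1 + exp x)\<^sup>2" by (simp add: power2_eq_square algebra_simps)
    thus ?thesis using nz by (simp add: divide_le_eq)
  qed
  hence "convex_on UNIV G"
    using DG DG' by (intro f''_ge0_imp_convex[where f' = "\<lambda>x. 2 * x + logistic x"
      and f'' = "\<lambda>x. 2 - exp x / (1 + exp x)\<^sup>2"]) auto
  hence "G (x + h) - G x \<ge> (2 * x + logistic x) * (x + h - x)"
    by (rule convex_on_imp_above_tangent) (use DG in auto)
  thus ?thesis by (simp add: G_def power2_eq_square algebra_simps)
qed

text \<open>The right-hand side is the square of \<open>shortfall x - h\<close>, and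
  \<open>shortfall (x + h)\<close> either vanishes or lies between 0 and
  \<open>shortfall x - h\<close>.\<close>

lemma shortfall_sq_upper: "(shortfall (x + h))\<^sup>2 \<le> (shortfall x)\<^sup>2 - 2 * shortfall x * h + h\<^sup>2"
proof -
  have *: "(shortfall x)\<^sup>2 - 2 * shortfall x * h + h\<^sup>2 = (shortfall x - h)\<^sup>2"
    by (simp add: power2_eq_square algebra_simps)
  show ?thesis
  proof (cases "- (x + h) - 1 \<le> 0")
    case True
    thus ?thesis unfolding * by (simp add: shortfall_def)
  next
    case False
    thus ?thesis unfolding * by (intro power_mono) (auto simp: shortfall_def)
  qed
qed

text \<open>The third bound keeps the normalising constant of the martingale density below 1.\<close>
lemma logistic_bounds: "0 < logistic x" "logistic x \<le> 1" "(1 + x) * logistic x \<le> 1"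
proof -
  have p: "1 + exp x > 0" by (simp add: add_pos_pos)
  thus "0 < logistic x" "logistic x \<le> 1" by (simp_all add: logistic_def)
  have "1 + x \<le> 1 + exp x" using exp_ge_add_one_self[of x] by linarith
  thus "(1 + x) * logistic x \<le> 1" using p by (simp add: logistic_def)
qed

lemma logistic_antimono: "x \<le> y \<Longrightarrow> logistic y \<le> logistic x"
  unfolding logistic_def by (intro divide_left_mono) (auto simp: add_pos_pos)

lemma softplus_nonneg: "0 \<le> softplus x"
  by (simp add: softplus_def)

lemma softplus_0: "softplus 0 \<le> 1"
  using ln_le_minus_one[of 2] by (simp add: softplus_def)

lemma softplus_growth: "softplus x \<le> 2 * (1 + x\<^sup>2)"
proof -
  have "softplus x \<le> 1 - x / 2 + x\<^sup>2"
    using softplus_upper[of 0 x] softplus_0 by (simp add: logistic_def)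
  moreover have "- x / 2 \<le> 1 + x\<^sup>2"
  proof -
    have "0 \<le> (x + 1)\<^sup>2" "0 \<le> x\<^sup>2" by simp_all
    moreover have "(x + 1)\<^sup>2 = x\<^sup>2 + 2 * x + 1" by (simp add: power2_eq_square algebra_simps)
    ultimately show ?thesis by linarith
  qed
  ultimately show ?thesis by (simp add: algebra_simps)
qed

lemma shortfall_nonneg: "0 \<le> shortfall x"
  by (simp add: shortfall_def)

lemma shortfall_growth: "(shortfall x)\<^sup>2 \<le> 2 * (1 + x\<^sup>2)"
proof -
  have "(shortfall x)\<^sup>2 \<le> (- x - 1)\<^sup>2" by (auto simp: shortfall_def max_def)
  also have "\<dots> \<le> 2 * (1 + x\<^sup>2)"
    using zero_le_power2[of "x - 1"] by (simp add: power2_eq_square algebra_simps)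
  finally show ?thesis .
qed

lemma continuous_softplus: "continuous_on A softplus"
  unfolding softplus_def[abs_def]
  by (intro continuous_intros) (metis add_pos_pos exp_gt_zero less_irrefl zero_less_one)

lemma continuous_logistic: "continuous_on A logistic"
  unfolding logistic_def[abs_def]
  by (intro continuous_intros) (metis add_pos_pos exp_gt_zero less_irrefl zero_less_one)

lemma continuous_shortfall: "continuous_on A shortfall"
  unfolding shortfall_def[abs_def] by (intro continuous_intros)

lemma measurable_logistic [measurable]: "logistic \<in> borel_measurable borel"
  and measurable_shortfall [measurable]: "shortfall \<in> borel_measurable borel"
  and measurable_softplus [measurable]: "softplus \<in> borel_measurable borel"
  by (intro borel_measurable_continuous_onI continuous_logistic continuous_shortfall continuous_softplus)+

section \<open>The combined loss, its derivative and their growth\<close>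

definition loss :: "real \<Rightarrow> real \<Rightarrow> real" where
  "loss a x = softplus x + a * (shortfall x)\<^sup>2"

definition neg_deriv_loss :: "real \<Rightarrow> real \<Rightarrow> real" where
  "neg_deriv_loss a x = logistic x + 2 * a * shortfall x"

text \<open>The quadratic upper bound replaces differentiation under the integral sign in the first-order
  condition below.\<close>
lemma loss_upper:
  assumes "a \<ge> 0"
  shows "loss a (x + h) \<le> loss a x - neg_deriv_loss a x * h + (1 + a) * h\<^sup>2"
  using add_mono[OF softplus_upper[of x h] mult_left_mono[OF shortfall_sq_upper[of x h] assms]]
  by (simp add: loss_def neg_deriv_loss_def algebra_simps)

lemma continuous_loss: "continuous_on A (loss a)"
  unfolding loss_def[abs_def] by (intro continuous_intros continuous_softplus continuous_shortfall)

lemma loss_growth: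
  assumes "a \<ge> 0"
  shows "\<bar>loss a x\<bar> \<le> (2 + 2 * a) * (1 + x\<^sup>2)"
  using add_mono[OF softplus_growth[of x] mult_left_mono[OF shortfall_growth[of x] assms]]
    softplus_nonneg[of x] assms
  by (simp add: loss_def algebra_simps)

lemma measurable_loss [measurable]: "loss a \<in> borel_measurable borel"
  unfolding loss_def[abs_def] by measurable

lemma measurable_neg_deriv_loss [measurable]: "neg_deriv_loss a \<in> borel_measurable borel"
  unfolding neg_deriv_loss_def[abs_def] by measurable

lemma neg_deriv_loss_pos: "a \<ge> 0 \<Longrightarrow> 0 < neg_deriv_loss a x"
  unfolding neg_deriv_loss_def using logistic_bounds(1)[of x] shortfall_nonneg[of x]
  by (simp add: add_pos_nonneg)

lemma neg_deriv_loss_sq_growth: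
  assumes "a \<ge> 0"
  shows "\<bar>(neg_deriv_loss a x)\<^sup>2\<bar> \<le> (2 + 16 * a\<^sup>2) * (1 + x\<^sup>2)"
proof -
  have "(logistic x)\<^sup>2 \<le> 1" using logistic_bounds[of x] by (simp add: power_le_one)
  moreover have "a\<^sup>2 * (shortfall x)\<^sup>2 \<le> a\<^sup>2 * (2 * (1 + x\<^sup>2))"
    by (intro mult_left_mono shortfall_growth) auto
  moreover have "(neg_deriv_loss a x)\<^sup>2 \<le> 2 * (logistic x)\<^sup>2 + 8 * (a\<^sup>2 * (shortfall x)\<^sup>2)"
    using zero_le_power2[of "logistic x - 2 * a * shortfall x"]
    by (simp add: neg_deriv_loss_def power2_eq_square algebra_simps)
  ultimately have "(neg_deriv_loss a x)\<^sup>2 \<le> 2 + 16 * (a\<^sup>2 * (1 + x\<^sup>2))" by linarith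
  also have "\<dots> \<le> (2 + 16 * a\<^sup>2) * (1 + x\<^sup>2)" by (simp add: algebra_simps)
  finally show ?thesis by simp
qed

lemma neg_deriv_loss_growth:
  assumes "a \<ge> 0"
  shows "\<bar>neg_deriv_loss a x\<bar> \<le> (3 + 16 * a\<^sup>2) * (1 + x\<^sup>2)"
proof -
  have "\<bar>neg_deriv_loss a x\<bar> \<le> 1 + (neg_deriv_loss a x)\<^sup>2"
    using zero_le_power2[of "\<bar>neg_deriv_loss a x\<bar> - 1/2"]
    by (simp add: power2_eq_square algebra_simps)
  also have "\<dots> \<le> (1 + x\<^sup>2) + (2 + 16 * a\<^sup>2) * (1 + x\<^sup>2)"
    using neg_deriv_loss_sq_growth[OF assms, of x] by (intro add_mono) auto
  finally show ?thesis by (simp add: algebra_simps)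
qed

section \<open>Compact boxes of strategies\<close>

definition strategy_box :: "nat set \<Rightarrow> real \<Rightarrow> (nat \<Rightarrow> real) set" where
  "strategy_box I r = {H. \<forall>i. \<bar>H i\<bar> \<le> (if i \<in> I then r else 0)}"

text \<open>Tychonoff's theorem: the box is a product of compact intervals, degenerate ones for the
  coordinates outside \<open>I\<close>, and so is compact in the whole function space.\<close>

lemma compact_strategy_box: "compact (strategy_box I r)"
proof -
  let ?B = "\<lambda>i. if i \<in> I then {-r..r} else {0 :: real}"
  have "compactin (product_topology (\<lambda>_. euclidean) UNIV) (PiE UNIV ?B)"
    by (subst compactin_PiE) auto
  moreover have "PiE UNIV ?B = strategy_box I r"
    by (auto simp: strategy_box_def PiE_def Pi_def abs_le_iff split: if_splits intro: antisym)
  ultimately show ?thesis by (simp add: euclidean_product_topology)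
qed

lemma strategy_boxD:
  assumes "H \<in> strategy_box I r"
  shows "i \<in> I \<Longrightarrow> \<bar>H i\<bar> \<le> r" "i \<notin> I \<Longrightarrow> H i = 0"
  using assms unfolding strategy_box_def by (auto dest: spec[of _ i])

lemma closed_strategy_box_face:
  assumes "finite I"
  shows "closed {H :: nat \<Rightarrow> real. \<exists>i\<in>I. \<bar>H i\<bar> = r}"
proof -
  have "closed {H :: nat \<Rightarrow> real. \<bar>H i\<bar> = r}" for i
    by (intro closed_Collect_eq continuous_intros) auto
  moreover have "{H :: nat \<Rightarrow> real. \<exists>i\<in>I. \<bar>H i\<bar> = r} = (\<Union>i\<in>I. {H. \<bar>H i\<bar> = r})" by auto
  ultimately show ?thesis using assms by auto
qed

text \<open>An infinite positive or negative part makes the generalised expectation infinite, by the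
  convention also when both are infinite. The value 0 therefore forces integrability.\<close>

lemma gen_expectation_eq_0_iff:
  assumes [measurable]: "f \<in> borel_measurable Q"
  shows "gen_expectation Q f = 0 \<longleftrightarrow> integrable Q f \<and> integral\<^sup>L Q f = 0"
proof -
  define p m where "p = (\<integral>\<^sup>+\<omega>. ennreal (f \<omega>) \<partial>Q)" and "m = (\<integral>\<^sup>+\<omega>. ennreal (- f \<omega>) \<partial>Q)"
  have g: "gen_expectation Q f =
      (if p = \<infinity> \<and> m = \<infinity> then - \<infinity> else enn2ereal p - enn2ereal m)"
    by (simp add: gen_expectation_def Let_def p_def m_def ennreal_max_0)
  have i: "integrable Q f \<longleftrightarrow> p \<noteq> \<infinity> \<and> m \<noteq> \<infinity>"
    by (simp add: real_integrable_def p_def m_def)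
  show ?thesis
  proof (cases "integrable Q f")
    case True
    have "integral\<^sup>L Q f = enn2real p - enn2real m"
      unfolding p_def m_def by (rule real_lebesgue_integral_def[OF True])
    thus ?thesis using True i g
      by (cases p; cases m) (auto simp: zero_ereal_def)
  next
    case False
    thus ?thesis using i g by (cases p; cases m) auto
  qed
qed

section \<open>One market: compactness and the first-order condition\<close>

text \<open>Linear independence, modulo quasi-sure equality, of the price increments with index in
  \<open>I\<close>.\<close>

definition non_redundant ::
  "'a measure \<Rightarrow> 'a measure set \<Rightarrow> nat \<Rightarrow> (nat \<Rightarrow> real) \<Rightarrow> (nat \<Rightarrow> 'a \<Rightarrow> real) \<Rightarrow> nat set \<Rightarrow> bool" where
  "non_redundant M \<P> d S0 S1 I \<longleftrightarrow> (\<forall>H. (\<forall>i. i \<notin> I \<longrightarrow> H i = 0) \<longrightarrow>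
     qs M \<P> (\<lambda>\<omega>. gain d S0 S1 H \<omega> = 0) \<longrightarrow> (\<forall>i. H i = 0))"

context robust_market
begin

text \<open>A maximal independent family of price increments spans all the others, as for bases of a
  vector space.\<close>

lemma exists_spanning_non_redundant:
  "\<exists>I\<subseteq>{1..d}. non_redundant M \<P> d S0 S1 I \<and>
     (\<forall>j\<in>{1..d}. \<exists>G. (\<forall>i. i \<notin> I \<longrightarrow> G i = 0) \<and>
        qs M \<P> (\<lambda>\<omega>. S1 j \<omega> - S0 j = gain d S0 S1 G \<omega>))"
proof -
  note [measurable] = measurable_S1
  let ?A = "{I. I \<subseteq> {1..d} \<and> non_redundant M \<P> d S0 S1 I}"
  have "finite ?A" by (rule finite_subset[of _ "Pow {1..d}"]) auto
  moreover have "?A \<noteq> {}" by (auto simp: non_redundant_def intro!: exI[of _ "{}"])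
  ultimately have "\<exists>I\<in>?A. \<forall>J\<in>?A. I \<subseteq> J \<longrightarrow> I = J" by (rule finite_has_maximal)
  then obtain I where I: "I \<in> ?A" and max: "\<And>J. J \<in> ?A \<Longrightarrow> I \<subseteq> J \<Longrightarrow> I = J"
    by (elim bexE) simp
  have "\<exists>G. (\<forall>i. i \<notin> I \<longrightarrow> G i = 0) \<and> qs M \<P> (\<lambda>\<omega>. S1 j \<omega> - S0 j = gain d S0 S1 G \<omega>)"
    if j: "j \<in> {1..d}" for j
  proof (cases "j \<in> I")
    case True
    thus ?thesis
      using j by (intro exI[of _ "\<lambda>i. if i = j then 1 else 0"]) (auto simp: gain_unit qs_def polar_def)
  next
    case False
    with max[of "insert j I"] I j have "\<not> non_redundant M \<P> d S0 S1 (insert j I)" by auto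
    then obtain H where H: "\<forall>i. i \<notin> insert j I \<longrightarrow> H i = 0"
      "qs M \<P> (\<lambda>\<omega>. gain d S0 S1 H \<omega> = 0)" "\<exists>i. H i \<noteq> 0"
      unfolding non_redundant_def by blast
    \<comment> \<open>A relation without the new asset \<open>j\<close> would contradict the
      independence of \<open>I\<close>; hence the relation can be solved for the increment of
      \<open>j\<close>, which yields \<open>G\<close>.\<close>
    have Hj: "H j \<noteq> 0"
    proof
      assume "H j = 0"
      hence "\<forall>i. i \<notin> I \<longrightarrow> H i = 0" using H(1) by auto
      thus False using H I unfolding non_redundant_def by blast
    qed
    define G where "G i = (if i = j then 0 else - (H i / H j))" for i
    have "gain d S0 S1 H \<omega> = H j * ((S1 j \<omega> - S0 j) - gain d S0 S1 G \<omega>)" for \<omega>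
    proof -
      have "H = (\<lambda>i. (H j * (if i = j then 1 else 0)) + (- H j) * G i)"
        using Hj by (auto simp: G_def)
      hence "gain d S0 S1 H \<omega> = gain d S0 S1 (\<lambda>i. (H j * (if i = j then 1 else 0)) + (- H j) * G i) \<omega>"
        by simp
      thus ?thesis unfolding gain_add gain_scale gain_unit[OF j] by (simp add: algebra_simps)
    qed
    hence "gain d S0 S1 H \<omega> = 0 \<longleftrightarrow> S1 j \<omega> - S0 j = gain d S0 S1 G \<omega>" for \<omega>
      using Hj by simp
    hence "qs M \<P> (\<lambda>\<omega>. S1 j \<omega> - S0 j = gain d S0 S1 G \<omega>)"
      using H(2) by presburger
    moreover have "\<forall>i. i \<notin> I \<longrightarrow> G i = 0" using H(1) by (auto simp: G_def)
    ultimately show ?thesis by blast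
  qed
  with I show ?thesis by blast
qed

text \<open>By NA and independence every strategy on the unit sphere makes a loss under some prior.
  By compactness a single prior sees a weighted mean squared loss of at least some
  \<open>s > 0\<close> on the whole sphere. A large admissible strategy, scaled to the sphere, would
  lose too little for that.\<close>

lemma bounded_admissible:
  assumes NA: "NA M \<P> d S0 S1" and I: "finite I" "non_redundant M \<P> d S0 S1 I"
  shows "\<exists>r>0. \<forall>H. (\<forall>i. i \<notin> I \<longrightarrow> H i = 0) \<longrightarrow> qs M \<P> (\<lambda>\<omega>. gain d S0 S1 H \<omega> \<ge> -1) \<longrightarrow>
    (\<forall>i\<in>I. \<bar>H i\<bar> < r)"
proof -
  \<comment> \<open>The unit sphere of the maximum norm on strategies supported in
    \<open>I\<close>.\<close>
  define T where "T = strategy_box I 1 \<inter> {H. \<exists>i\<in>I. \<bar>H i\<bar> = 1}"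
  define f :: "real \<Rightarrow> real" where "f x = (max 0 (- x))\<^sup>2" for x
  have "compact T" unfolding T_def by (intro compact_Int_closed compact_strategy_box closed_strategy_box_face I)
  obtain P where P: "P \<in> \<P>" using nonempty by auto
  have cont: "continuous_on UNIV f" unfolding f_def by (intro continuous_intros)
  have f: "\<bar>f x\<bar> \<le> 1 * (1 + x\<^sup>2)" for x by (auto simp: f_def max_def)
  have nn: "f x \<ge> 0" for x by (simp add: f_def)
  have f_eq_0: "f x = 0 \<longleftrightarrow> 0 \<le> x" for x by (auto simp: f_def max_def)
  have T: "\<not> qs M \<P> (\<lambda>\<omega>. f (gain d S0 S1 H \<omega>) = 0)" if H: "H \<in> T" for H
  proof
    assume "qs M \<P> (\<lambda>\<omega>. f (gain d S0 S1 H \<omega>) = 0)"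
    hence "qs M \<P> (\<lambda>\<omega>. gain d S0 S1 H \<omega> \<ge> 0)"
      by (simp add: f_eq_0)
    hence "qs M \<P> (\<lambda>\<omega>. gain d S0 S1 H \<omega> = 0)" using NA by (simp add: NA_def)
    moreover have "\<forall>i. i \<notin> I \<longrightarrow> H i = 0" using H strategy_boxD(2) by (auto simp: T_def)
    ultimately have "\<forall>i. H i = 0" using I(2) unfolding non_redundant_def by blast
    thus False using H by (auto simp: T_def)
  qed
  obtain R s where R: "R \<in> \<P>" and s: "s > 0"
    "\<forall>H\<in>T. s \<le> (\<integral>\<omega>. tame_weight d S0 S1 1 \<omega> * f (gain d S0 S1 H \<omega>) \<partial>R)"
    using exists_uniformly_charging_prior[OF \<open>compact T\<close> P zero_less_one cont f nn T] by blast
  interpret R: prob_space R using prior R by blast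
  \<comment> \<open>If the maximum norm \<open>l\<close> exceeds 1, then \<open>s\<close> is at most
    the square of \<open>1 / l\<close>, hence at most \<open>1 / l\<close>. The summand 1 covers
    norms up to 1 and makes the inequality strict.\<close>
  show ?thesis
  proof (intro exI[of _ "1 + 1 / s"] conjI allI impI ballI)
    show "1 + 1 / s > 0" using s by (simp add: add_pos_pos)
    fix H i assume H: "\<forall>i. i \<notin> I \<longrightarrow> H i = 0" "qs M \<P> (\<lambda>\<omega>. gain d S0 S1 H \<omega> \<ge> -1)" and i: "i \<in> I"
    define l where "l = Max ((\<lambda>i. \<bar>H i\<bar>) ` I)"
    have le: "\<bar>H k\<bar> \<le> l" if "k \<in> I" for k using that I unfolding l_def by auto
    have "l \<in> (\<lambda>i. \<bar>H i\<bar>) ` I" unfolding l_def using i I by (intro Max_in) auto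
    then obtain k where k: "k \<in> I" "\<bar>H k\<bar> = l" by auto
    have "l < 1 + 1 / s"
    proof (cases "l \<le> 1")
      case False
      hence l: "l > 1" by simp
      \<comment> \<open>Scaling to the unit sphere turns the lower bound -1 on the gain into
        \<open>- 1 / l\<close>.\<close>
      define G where "G = (\<lambda>i. (1 / l) * H i)"
      have "G \<in> T" using H(1) k le l by (auto simp: T_def strategy_box_def G_def abs_mult)
      hence "s \<le> (\<integral>\<omega>. tame_weight d S0 S1 1 \<omega> * f (gain d S0 S1 G \<omega>) \<partial>R)" using s by blast
      also have "\<dots> \<le> (\<integral>\<omega>. (1 / l)\<^sup>2 \<partial>R)"
      proof (rule integral_mono_AE)
        show "integrable R (\<lambda>\<omega>. tame_weight d S0 S1 1 \<omega> * f (gain d S0 S1 G \<omega>))"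
          using prior[OF R] f borel_measurable_continuous_onI[OF cont]
          by (intro integrable_tame_weight[where C = 1]) auto
        have "AE \<omega> in R. gain d S0 S1 H \<omega> \<ge> -1" using qs_imp_AE[OF H(2) R] .
        thus "AE \<omega> in R. tame_weight d S0 S1 1 \<omega> * f (gain d S0 S1 G \<omega>) \<le> (1 / l)\<^sup>2"
        proof eventually_elim
          case (elim \<omega>)
          have "max 0 (- gain d S0 S1 G \<omega>) \<le> 1 / l"
            using elim l unfolding G_def gain_scale by (simp add: field_simps)
          hence "f (gain d S0 S1 G \<omega>) \<le> (1 / l)\<^sup>2" unfolding f_def by (intro power_mono) auto
          moreover have "tame_weight d S0 S1 1 \<omega> * f (gain d S0 S1 G \<omega>) \<le> 1 * f (gain d S0 S1 G \<omega>)"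
            using nn by (intro mult_right_mono tame_weight_bounds) auto
          ultimately show ?case by simp
        qed
      qed auto
      also have "\<dots> = (1 / l)\<^sup>2" by (simp add: R.prob_space)
      also have "\<dots> \<le> 1 / l" using l by (simp add: power2_eq_square field_simps)
      finally have "l \<le> 1 / s" using l s by (simp add: field_simps)
      thus ?thesis by simp
    qed (use s in \<open>auto intro: le_less_trans\<close>)
    thus "\<bar>H i\<bar> < 1 + 1 / s" using le[OF i] by simp
  qed
qed

text \<open>The sum of squared increments is finite, so it exceeds \<open>k\<close> with probability
  tending to 0. With \<eta> equal to \<open>1 / (k + 1)\<close>, a weight below 1/2 forces it above
  \<open>k\<close>.\<close>

lemma exists_tame_weight_near_1:
  assumes "P \<in> \<P>" "e > 0"
  shows "\<exists>\<eta>>0. measure P {\<omega> \<in> space M. tame_weight d S0 S1 \<eta> \<omega> < 1 / 2} \<le> e"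
proof -
  note [measurable] = measurable_S1
  interpret P: prob_space P using prior assms by blast
  have [measurable_cong]: "sets P = sets M" using prior assms by blast
  define V where "V \<omega> = (\<Sum>i=1..d. (S1 i \<omega> - S0 i)\<^sup>2)" for \<omega>
  have [measurable]: "V \<in> borel_measurable M" unfolding V_def[abs_def] by measurable
  define A where "A k = {\<omega> \<in> space M. real k < V \<omega>}" for k
  have "(\<Inter>k. A k) = {}"
  proof -
    have "\<exists>k. \<omega> \<notin> A k" for \<omega>
      using real_arch_simple[of "V \<omega>"] by (auto simp: A_def not_less)
    thus ?thesis by blast
  qed
  moreover have "(\<lambda>k. measure P (A k)) \<longlonglongrightarrow> measure P (\<Inter>k. A k)"
    by (rule P.finite_Lim_measure_decseq) (auto simp: A_def decseq_def)
  ultimately have "(\<lambda>k. measure P (A k)) \<longlonglongrightarrow> 0" by simp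
  hence "eventually (\<lambda>k. measure P (A k) < e) sequentially" using assms(2) by (rule order_tendstoD)
  then obtain k where k: "measure P (A k) < e" by (auto simp: eventually_sequentially)
  have "{\<omega> \<in> space M. tame_weight d S0 S1 (1 / (real k + 1)) \<omega> < 1 / 2} \<subseteq> A k"
  proof safe
    fix \<omega> assume \<omega>: "\<omega> \<in> space M" "tame_weight d S0 S1 (1 / (real k + 1)) \<omega> < 1 / 2"
    have "V \<omega> \<ge> 0" by (auto simp: V_def intro!: sum_nonneg)
    have "1 / (1 + (1 / (real k + 1)) * V \<omega>) < 1 / 2"
      using \<omega>(2) by (simp add: tame_weight_def V_def)
    hence "(1 / (real k + 1)) * V \<omega> > 1" using \<open>V \<omega> \<ge> 0\<close>
      by (subst (asm) divide_less_eq) (auto split: if_splits simp: add_pos_nonneg field_simps)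
    hence "V \<omega> > real k" by (simp add: field_simps)
    with \<omega> show "\<omega> \<in> A k" by (simp add: A_def)
  qed
  hence "measure P {\<omega> \<in> space M. tame_weight d S0 S1 (1 / (real k + 1)) \<omega> < 1 / 2} \<le> measure P (A k)"
    by (intro P.finite_measure_mono) (auto simp: A_def)
  with k show ?thesis by (intro exI[of _ "1 / (real k + 1)"]) auto
qed

text \<open>The product of two factors is at most the sum of their squares in absolute value, and
  the weight makes both squares integrable.\<close>

lemma integrable_pricing:
  assumes R: "prob_space R" "sets R = sets M" and "\<eta> > 0" "a \<ge> 0"
  shows "integrable R (\<lambda>\<omega>. tame_weight d S0 S1 \<eta> \<omega> * neg_deriv_loss a (gain d S0 S1 H \<omega>) * gain d S0 S1 G \<omega>)"
proof -
  note [measurable_cong] = R(2)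
  let ?w = "tame_weight d S0 S1 \<eta>"
  have "integrable R (\<lambda>\<omega>. ?w \<omega> * (neg_deriv_loss a (gain d S0 S1 H \<omega>))\<^sup>2 + ?w \<omega> * (gain d S0 S1 G \<omega>)\<^sup>2)"
    using assms neg_deriv_loss_sq_growth[OF assms(4)]
    by (intro Bochner_Integration.integrable_add integrable_tame_weight[where C = 1]
        integrable_tame_weight[where f = "\<lambda>x. (neg_deriv_loss a x)\<^sup>2"]) auto
  thus ?thesis
  proof (rule Bochner_Integration.integrable_bound)
    show "AE \<omega> in R. norm (?w \<omega> * neg_deriv_loss a (gain d S0 S1 H \<omega>) * gain d S0 S1 G \<omega>)
      \<le> norm (?w \<omega> * (neg_deriv_loss a (gain d S0 S1 H \<omega>))\<^sup>2 + ?w \<omega> * (gain d S0 S1 G \<omega>)\<^sup>2)"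
    proof (rule AE_I2)
      fix \<omega>
      define v x where "v = neg_deriv_loss a (gain d S0 S1 H \<omega>)" and "x = gain d S0 S1 G \<omega>"
      have w: "?w \<omega> > 0" by (rule tame_weight_bounds) fact
      have "\<bar>v * x\<bar> \<le> v\<^sup>2 + x\<^sup>2"
      proof -
        have "0 \<le> (\<bar>v\<bar> - \<bar>x\<bar>)\<^sup>2" "0 \<le> v\<^sup>2 + x\<^sup>2" by simp_all
        moreover have "(\<bar>v\<bar> - \<bar>x\<bar>)\<^sup>2 = v\<^sup>2 + x\<^sup>2 - 2 * \<bar>v * x\<bar>"
          by (simp add: power2_diff abs_mult)
        ultimately show ?thesis by linarith
      qed
      hence "?w \<omega> * \<bar>v * x\<bar> \<le> ?w \<omega> * (v\<^sup>2 + x\<^sup>2)" using w by (intro mult_left_mono) auto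
      moreover have "0 \<le> ?w \<omega> * v\<^sup>2 + ?w \<omega> * x\<^sup>2" using w by simp
      ultimately show "norm (?w \<omega> * v * x) \<le> norm (?w \<omega> * v\<^sup>2 + ?w \<omega> * x\<^sup>2)"
        using w by (simp add: abs_mult algebra_simps)
    qed
  qed measurable
qed

lemma pricing_linear:
  assumes R: "prob_space R" "sets R = sets M" and "\<eta> > 0" "a \<ge> 0"
  shows "(\<integral>\<omega>. tame_weight d S0 S1 \<eta> \<omega> * neg_deriv_loss a (gain d S0 S1 H \<omega>) * gain d S0 S1 G \<omega> \<partial>R)
    = (\<Sum>i=1..d. G i * (\<integral>\<omega>. tame_weight d S0 S1 \<eta> \<omega> * neg_deriv_loss a (gain d S0 S1 H \<omega>) *
        (S1 i \<omega> - S0 i) \<partial>R))"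
proof -
  let ?g = "\<lambda>\<omega>. tame_weight d S0 S1 \<eta> \<omega> * neg_deriv_loss a (gain d S0 S1 H \<omega>)"
  have int: "integrable R (\<lambda>\<omega>. ?g \<omega> * (S1 i \<omega> - S0 i))" if "i \<in> {1..d}" for i
    using integrable_pricing[OF assms, of S0 H "\<lambda>k. if k = i then 1 else 0"] gain_unit[OF that, of S0 S1]
    by simp
  have "(\<integral>\<omega>. ?g \<omega> * gain d S0 S1 G \<omega> \<partial>R) = (\<integral>\<omega>. (\<Sum>i=1..d. G i * (?g \<omega> * (S1 i \<omega> - S0 i))) \<partial>R)"
    by (simp add: gain_def[of d S0 S1 G] sum_distrib_left mult_ac)
  also have "\<dots> = (\<Sum>i=1..d. \<integral>\<omega>. G i * (?g \<omega> * (S1 i \<omega> - S0 i)) \<partial>R)"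
    using int by (intro Bochner_Integration.integral_sum integrable_mult_right) auto
  finally show ?thesis by simp
qed

text \<open>Moving the holding in asset \<open>i\<close> by \<open>t\<close> and applying the
  quadratic upper bound gives \<open>t * c \<le> D * t\<^sup>2\<close> for all small
  \<open>t\<close> of either sign, where \<open>c\<close> is the integral in question. This forces
  \<open>c = 0\<close>.\<close>

lemma pricing_eq_0_of_local_min:
  assumes R: "prob_space R" "sets R = sets M" and "\<eta> > 0" "a \<ge> 0" "i \<in> {1..d}" "\<tau> > 0"
    and min: "\<And>t. \<bar>t\<bar> < \<tau> \<Longrightarrow> (\<integral>\<omega>. tame_weight d S0 S1 \<eta> \<omega> * loss a (gain d S0 S1 H \<omega>) \<partial>R) \<le>
      (\<integral>\<omega>. tame_weight d S0 S1 \<eta> \<omega> *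
        loss a (gain d S0 S1 (\<lambda>k. H k + t * (if k = i then 1 else 0)) \<omega>) \<partial>R)"
  shows "(\<integral>\<omega>. tame_weight d S0 S1 \<eta> \<omega> * neg_deriv_loss a (gain d S0 S1 H \<omega>) * (S1 i \<omega> - S0 i) \<partial>R) = 0"
proof -
  let ?w = "tame_weight d S0 S1 \<eta>" and ?X = "gain d S0 S1 H" and ?Y = "\<lambda>\<omega>. S1 i \<omega> - S0 i"
  define c where "c = (\<integral>\<omega>. ?w \<omega> * neg_deriv_loss a (?X \<omega>) * ?Y \<omega> \<partial>R)"
  define D where "D = (1 + a) * (\<integral>\<omega>. ?w \<omega> * (?Y \<omega>)\<^sup>2 \<partial>R)"
  have Y: "gain d S0 S1 (\<lambda>k. if k = i then 1 else 0) = ?Y" by (intro ext gain_unit assms)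
  have i1: "integrable R (\<lambda>\<omega>. ?w \<omega> * loss a (gain d S0 S1 G \<omega>))" for G
    using assms loss_growth[OF assms(4)] by (intro integrable_tame_weight) auto
  have i2: "integrable R (\<lambda>\<omega>. ?w \<omega> * neg_deriv_loss a (?X \<omega>) * ?Y \<omega>)"
    using integrable_pricing[OF R assms(3,4)] Y by metis
  have i3: "integrable R (\<lambda>\<omega>. ?w \<omega> * (?Y \<omega>)\<^sup>2)"
    using integrable_tame_weight[OF R assms(3), of "\<lambda>x. x\<^sup>2" 1 S0 "\<lambda>k. if k = i then 1 else 0"] Y by auto
  have key: "t * c \<le> D * t\<^sup>2" if "\<bar>t\<bar> < \<tau>" for t
  proof -
    let ?H = "\<lambda>k. H k + t * (if k = i then 1 else 0)"
    have "(\<integral>\<omega>. ?w \<omega> * loss a (?X \<omega>) \<partial>R) \<le> (\<integral>\<omega>. ?w \<omega> * loss a (gain d S0 S1 ?H \<omega>) \<partial>R)"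
      by (rule min) fact
    also have "\<dots> \<le> (\<integral>\<omega>. ?w \<omega> * loss a (?X \<omega>) - t * (?w \<omega> * neg_deriv_loss a (?X \<omega>) * ?Y \<omega>) +
        (1 + a) * t\<^sup>2 * (?w \<omega> * (?Y \<omega>)\<^sup>2) \<partial>R)"
    proof (rule integral_mono)
      fix \<omega>
      have "?w \<omega> * loss a (?X \<omega> + t * y) \<le> ?w \<omega> * loss a (?X \<omega>)
          - t * (?w \<omega> * neg_deriv_loss a (?X \<omega>) * y) + (1 + a) * t\<^sup>2 * (?w \<omega> * y\<^sup>2)" for y
      proof -
        have "?w \<omega> * loss a (?X \<omega> + t * y) \<le> ?w \<omega> * (loss a (?X \<omega>)
            - neg_deriv_loss a (?X \<omega>) * (t * y) + (1 + a) * (t * y)\<^sup>2)"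
          using tame_weight_bounds(1)[OF assms(3), of d S0 S1 \<omega>]
          by (intro mult_left_mono loss_upper assms) auto
        thus ?thesis by (simp add: algebra_simps power_mult_distrib)
      qed
      from this[of "?Y \<omega>"]
      show "?w \<omega> * loss a (gain d S0 S1 ?H \<omega>) \<le> ?w \<omega> * loss a (?X \<omega>)
          - t * (?w \<omega> * neg_deriv_loss a (?X \<omega>) * ?Y \<omega>) + (1 + a) * t\<^sup>2 * (?w \<omega> * (?Y \<omega>)\<^sup>2)"
        unfolding gain_add gain_scale Y .
    qed (intro i1 i2 i3 Bochner_Integration.integrable_add Bochner_Integration.integrable_diff
        integrable_mult_right)+
    also have "\<dots> = (\<integral>\<omega>. ?w \<omega> * loss a (?X \<omega>) \<partial>R) - t * c + D * t\<^sup>2"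
      using i1[of H] i2 i3 by (simp add: c_def D_def)
    finally show ?thesis by simp
  qed
  have Dn: "D \<ge> 0" unfolding D_def using assms(4) tame_weight_bounds(1)[OF assms(3), of d S0 S1]
    by (intro mult_nonneg_nonneg integral_nonneg_AE AE_I2) (auto simp: less_imp_le)
  have "c = 0"
  proof (rule ccontr)
    assume c: "c \<noteq> 0"
    \<comment> \<open>Small enough to stay in the range of minimality and to make the quadratic term
      less than the linear one. Using \<open>D + 1\<close> avoids division by 0.\<close>
    define t where "t = min (\<tau> / 2) (\<bar>c\<bar> / (2 * (D + 1)))"
    have t: "t > 0" "t < \<tau>" "t \<le> \<bar>c\<bar> / (2 * (D + 1))" using c Dn assms(6) by (auto simp: t_def)
    have "t * \<bar>c\<bar> \<le> D * t\<^sup>2" using key[of t] key[of "- t"] t by (auto simp: abs_if)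
    hence "\<bar>c\<bar> \<le> D * t" using t(1) by (simp add: power2_eq_square)
    also have "\<dots> \<le> (D + 1) * t" using t by (simp add: algebra_simps)
    also have "\<dots> \<le> \<bar>c\<bar> / 2" using t(3) Dn by (simp add: field_simps)
    finally show False using c by simp
  qed
  thus ?thesis by (simp add: c_def)
qed

end

section \<open>One market: existence of martingale measures with uniform bounds\<close>

text \<open>A continuous function between the indicators of \<open>x \<ge> k + 1\<close> and
  \<open>x \<ge> k\<close>. Continuity makes conditions on its integral closed conditions on the
  strategy.\<close>

definition ramp :: "real \<Rightarrow> real \<Rightarrow> real" where
  "ramp k x = min 1 (max 0 (x - k))"

lemma continuous_ramp: "continuous_on A (ramp k)"
  unfolding ramp_def[abs_def] by (intro continuous_intros)

lemma ramp_bounds: "0 \<le> ramp k x" "ramp k x \<le> 1"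
  by (auto simp: ramp_def)

lemma ramp_growth: "\<bar>ramp k x\<bar> \<le> 1 * (1 + x\<^sup>2)"
  using ramp_bounds[of k x] by (simp add: add_increasing2)

context robust_market
begin

lemma ramp_integral_le:
  assumes P: "P \<in> \<P>" and "\<eta> > 0"
  shows "(\<integral>\<omega>. tame_weight d S0 S1 \<eta> \<omega> * ramp k (gain d S0 S1 H \<omega>) \<partial>P)
    \<le> measure P {\<omega> \<in> space M. k \<le> gain d S0 S1 H \<omega>}"
proof -
  interpret P: prob_space P using prior P by blast
  have [measurable_cong]: "sets P = sets M" using prior P by blast
  let ?A = "{\<omega> \<in> space M. k \<le> gain d S0 S1 H \<omega>}"
  have A: "?A \<in> sets P" by measurable
  have "(\<integral>\<omega>. tame_weight d S0 S1 \<eta> \<omega> * ramp k (gain d S0 S1 H \<omega>) \<partial>P) \<le> (\<integral>\<omega>. indicator ?A \<omega> \<partial>P)"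
  proof (rule integral_mono)
    show "integrable P (\<lambda>\<omega>. tame_weight d S0 S1 \<eta> \<omega> * ramp k (gain d S0 S1 H \<omega>))"
      using prior[OF P] assms(2) ramp_growth borel_measurable_continuous_onI[OF continuous_ramp]
      by (intro integrable_tame_weight[where C = 1]) auto
    fix \<omega> assume "\<omega> \<in> space P"
    hence \<omega>: "\<omega> \<in> space M" using space_prior[OF P] by simp
    note w = tame_weight_bounds(1,2)[OF assms(2), of d S0 S1 \<omega>]
    show "tame_weight d S0 S1 \<eta> \<omega> * ramp k (gain d S0 S1 H \<omega>) \<le> indicator ?A \<omega>"
    proof (cases "\<omega> \<in> ?A")
      case True
      thus ?thesis using w ramp_bounds by (auto intro: mult_le_one)
    next
      case False
      thus ?thesis using \<omega> by (simp add: ramp_def)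
    qed
  qed (use A in \<open>auto simp: less_top[symmetric]\<close>)
  also have "\<dots> = measure P ?A" using A space_prior[OF P] by simp
  finally show ?thesis .
qed

text \<open>On the event the ramp equals 1 and the weight is at least 1/2, whence the factor
  2.\<close>

lemma measure_le_ramp_integral:
  assumes P: "P \<in> \<P>" and "\<eta> > 0"
  shows "measure P {\<omega> \<in> space M. 1 / 2 \<le> tame_weight d S0 S1 \<eta> \<omega> \<and> k + 1 \<le> gain d S0 S1 H \<omega>}
    \<le> 2 * (\<integral>\<omega>. tame_weight d S0 S1 \<eta> \<omega> * ramp k (gain d S0 S1 H \<omega>) \<partial>P)"
proof -
  interpret P: prob_space P using prior P by blast
  have [measurable_cong]: "sets P = sets M" using prior P by blast
  let ?A = "{\<omega> \<in> space M. 1 / 2 \<le> tame_weight d S0 S1 \<eta> \<omega> \<and> k + 1 \<le> gain d S0 S1 H \<omega>}"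
  have A: "?A \<in> sets P" by measurable
  have "measure P ?A = (\<integral>\<omega>. indicator ?A \<omega> \<partial>P)" using A space_prior[OF P] by simp
  also have "\<dots> \<le> (\<integral>\<omega>. 2 * (tame_weight d S0 S1 \<eta> \<omega> * ramp k (gain d S0 S1 H \<omega>)) \<partial>P)"
  proof (rule integral_mono)
    show "integrable P (\<lambda>\<omega>. 2 * (tame_weight d S0 S1 \<eta> \<omega> * ramp k (gain d S0 S1 H \<omega>)))"
      using prior[OF P] assms(2) ramp_growth borel_measurable_continuous_onI[OF continuous_ramp]
      by (intro integrable_mult_right integrable_tame_weight[where C = 1]) auto
    fix \<omega>
    note w = tame_weight_bounds(1,2)[OF assms(2), of d S0 S1 \<omega>]
    show "indicator ?A \<omega> \<le> 2 * (tame_weight d S0 S1 \<eta> \<omega> * ramp k (gain d S0 S1 H \<omega>))"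
    proof (cases "\<omega> \<in> ?A")
      case True
      hence "ramp k (gain d S0 S1 H \<omega>) = 1" by (auto simp: ramp_def)
      thus ?thesis using True by simp
    next
      case False
      thus ?thesis using w ramp_bounds[of k] by simp
    qed
  qed (use A in \<open>auto simp: less_top[symmetric]\<close>)
  finally show ?thesis by simp
qed

text \<open>The constants depend on the market only through \<open>K j\<close> and
  \<open>\<epsilon> j\<close>, so they are uniform once the bounds in probability are. The finite
  index set \<open>J\<close> lets one measure serve several tolerances.\<close>

lemma exists_martingale_measure:
  assumes NA: "NA M \<P> d S0 S1" and P: "P \<in> \<P>" and J: "finite J" "\<And>j. j \<in> J \<Longrightarrow> \<epsilon> j > 0"
    and unif: "\<And>j H. j \<in> J \<Longrightarrow> qs M \<P> (\<lambda>\<omega>. gain d S0 S1 H \<omega> \<ge> -1) \<Longrightarrow>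
      measure P {\<omega> \<in> space M. K j \<le> gain d S0 S1 H \<omega>} \<le> \<epsilon> j"
  shows "\<exists>Q\<in>martingale_measures M \<P> d S0 S1. \<forall>j\<in>J. \<forall>A\<in>sets M.
    measure P A \<le> 4 * (1 + exp (K j + 1)) * measure Q A + 5 * \<epsilon> j"
proof -
  note [measurable] = measurable_S1
  interpret P: prob_space P using prior P by blast
  have [measurable_cong]: "sets P = sets M" using prior P by blast

  \<comment> \<open>Choice of the weight, the independent assets and the box\<close>
  have "\<exists>e>0. \<forall>j\<in>J. e \<le> \<epsilon> j"
  proof (cases "J = {}")
    case False
    thus ?thesis using J by (intro exI[of _ "Min (\<epsilon> ` J)"]) auto
  qed (auto intro: exI[of _ 1])
  then obtain e where e: "e > 0" "\<And>j. j \<in> J \<Longrightarrow> e \<le> \<epsilon> j" by blast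
  \<comment> \<open>One weight has to serve all tolerances in \<open>J\<close>, hence their common
    lower bound \<open>e\<close>.\<close>
  obtain \<eta> where \<eta>: "\<eta> > 0" "measure P {\<omega> \<in> space M. tame_weight d S0 S1 \<eta> \<omega> < 1 / 2} \<le> e"
    using exists_tame_weight_near_1[OF P e(1), of S0] by blast
  let ?w = "tame_weight d S0 S1 \<eta>" and ?X = "gain d S0 S1"
  obtain I where I: "I \<subseteq> {1..d}" "non_redundant M \<P> d S0 S1 I"
    and span: "\<And>j. j \<in> {1..d} \<Longrightarrow> \<exists>G. (\<forall>i. i \<notin> I \<longrightarrow> G i = 0) \<and>
      qs M \<P> (\<lambda>\<omega>. S1 j \<omega> - S0 j = ?X G \<omega>)"
    using exists_spanning_non_redundant[of S0] by blast
  have "finite I" using I(1) finite_subset by blast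
  obtain r where r: "r > 0" "\<And>H i. (\<forall>i. i \<notin> I \<longrightarrow> H i = 0) \<Longrightarrow>
      qs M \<P> (\<lambda>\<omega>. ?X H \<omega> \<ge> -1) \<Longrightarrow> i \<in> I \<Longrightarrow> \<bar>H i\<bar> < r"
    using bounded_admissible[OF NA \<open>finite I\<close> I(2)] by blast

  \<comment> \<open>\<open>T\<close> collects the strategies the minimiser must avoid: those on the boundary of the box and those
    with large gains under \<open>P\<close>.  All of them have a shortfall below \<open>-1\<close> under some prior.\<close>
  define B where "B j = {H. 2 * \<epsilon> j \<le> (\<integral>\<omega>. ?w \<omega> * ramp (K j) (?X H \<omega>) \<partial>P)}" for j
  define T where "T = strategy_box I r \<inter> ({H. \<exists>i\<in>I. \<bar>H i\<bar> = r} \<union> (\<Union>j\<in>J. B j))"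
  have "closed (B j)" for j
    unfolding B_def using prior[OF P] \<eta>(1)
    by (intro closed_Collect_le continuous_intros continuous_weighted_integral[where C = 1]
        continuous_ramp ramp_growth) auto
  hence "compact T"
    unfolding T_def using \<open>finite I\<close> J(1)
    by (intro compact_Int_closed compact_strategy_box closed_Un closed_strategy_box_face closed_UN) auto
  have shortfall_0: "(shortfall x)\<^sup>2 = 0 \<longleftrightarrow> -1 \<le> x" for x by (auto simp: shortfall_def max_def)
  have T: "\<not> qs M \<P> (\<lambda>\<omega>. (shortfall (?X H \<omega>))\<^sup>2 = 0)" if H: "H \<in> T" for H
  proof
    assume "qs M \<P> (\<lambda>\<omega>. (shortfall (?X H \<omega>))\<^sup>2 = 0)"
    hence qs: "qs M \<P> (\<lambda>\<omega>. ?X H \<omega> \<ge> -1)" unfolding shortfall_0 .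
    have "\<forall>i. i \<notin> I \<longrightarrow> H i = 0" using H strategy_boxD(2) by (auto simp: T_def)
    hence "\<not> (\<exists>i\<in>I. \<bar>H i\<bar> = r)" using r(2)[OF _ qs] by fastforce
    then obtain j where j: "j \<in> J" "H \<in> B j" using H by (auto simp: T_def)
    \<comment> \<open>The factor 2 in \<open>B\<close> makes this incompatible with the bound
      \<open>\<epsilon> j\<close> for admissible strategies.\<close>
    have "2 * \<epsilon> j \<le> measure P {\<omega> \<in> space M. K j \<le> ?X H \<omega>}"
      using j(2) ramp_integral_le[OF P \<eta>(1), of S0 "K j" H] by (auto simp: B_def)
    thus False using unif[OF j(1) qs] J(2)[OF j(1)] by simp
  qed
  obtain R s where R: "R \<in> \<P>" and dom: "\<And>A. A \<in> sets M \<Longrightarrow> measure P A \<le> 2 * measure R A"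
    and s: "s > 0" "\<And>H. H \<in> T \<Longrightarrow> s \<le> (\<integral>\<omega>. ?w \<omega> * (shortfall (?X H \<omega>))\<^sup>2 \<partial>R)"
  proof -
    have "continuous_on UNIV (\<lambda>x. (shortfall x)\<^sup>2)" by (intro continuous_intros continuous_shortfall)
    moreover have "\<bar>(shortfall x)\<^sup>2\<bar> \<le> 2 * (1 + x\<^sup>2)" for x using shortfall_growth by simp
    ultimately show thesis
      using exists_uniformly_charging_prior[OF \<open>compact T\<close> P \<eta>(1), of "\<lambda>x. (shortfall x)\<^sup>2" 2 S0, OF _ _ _ T]
        that by auto
  qed
  interpret R: prob_space R using prior R by blast
  have R_prob: "prob_space R" by (rule R.prob_space_axioms)
  have R_sets [measurable_cong]: "sets R = sets M" using prior R by blast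
  have R_space: "space R = space M" by (rule space_prior[OF R])

  \<comment> \<open>With this multiple the penalty alone costs at least 2 on \<open>T\<close>,
    whereas the zero strategy costs at most 1. So the minimiser avoids \<open>T\<close>.\<close>
  define a where "a = 2 / s"
  have a: "a \<ge> 0" using s(1) by (simp add: a_def)
  note w = tame_weight_bounds[OF \<eta>(1), of d S0 S1]
  define \<phi> where "\<phi> H = (\<integral>\<omega>. ?w \<omega> * loss a (?X H \<omega>) \<partial>R)" for H
  have "continuous_on (strategy_box I r) \<phi>"
    unfolding \<phi>_def using loss_growth[OF a]
    by (intro continuous_weighted_integral R_prob R_sets \<eta> continuous_loss) auto
  moreover have zero: "(\<lambda>_. 0) \<in> strategy_box I r" using r(1) by (auto simp: strategy_box_def)
  ultimately have "\<exists>H\<in>strategy_box I r. \<forall>H'\<in>strategy_box I r. \<phi> H \<le> \<phi> H'"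
    by (intro continuous_attains_inf compact_strategy_box) auto
  then obtain H where H: "H \<in> strategy_box I r" and min: "\<And>H'. H' \<in> strategy_box I r \<Longrightarrow> \<phi> H \<le> \<phi> H'"
    by blast
  have int_loss: "integrable R (\<lambda>\<omega>. ?w \<omega> * loss a (?X H \<omega>))" for H
    using loss_growth[OF a] by (intro integrable_tame_weight R_prob R_sets \<eta>) auto
  have int_short: "integrable R (\<lambda>\<omega>. ?w \<omega> * (shortfall (?X H \<omega>))\<^sup>2)" for H
    using shortfall_growth by (intro integrable_tame_weight[where C = 2] R_prob R_sets \<eta>) auto
  have "H \<notin> T"
  proof
    assume "H \<in> T"
    have "2 = a * s" using s(1) by (simp add: a_def)
    also have "\<dots> \<le> a * (\<integral>\<omega>. ?w \<omega> * (shortfall (?X H \<omega>))\<^sup>2 \<partial>R)"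
      using a s(2)[OF \<open>H \<in> T\<close>] by (rule mult_left_mono[rotated])
    also have "\<dots> = (\<integral>\<omega>. a * (?w \<omega> * (shortfall (?X H \<omega>))\<^sup>2) \<partial>R)" by simp
    also have "\<dots> \<le> \<phi> H"
      unfolding \<phi>_def using softplus_nonneg less_imp_le[OF w(1)]
      by (intro integral_mono int_loss integrable_mult_right int_short)
        (simp add: loss_def algebra_simps)
    also have "\<dots> \<le> \<phi> (\<lambda>_. 0)" by (rule min[OF zero])
    also have "\<dots> \<le> (\<integral>\<omega>. 1 \<partial>R)"
      unfolding \<phi>_def using softplus_0 softplus_nonneg w(1,2)
      by (intro integral_mono int_loss)
        (auto simp: gain_zero loss_def shortfall_def less_imp_le intro!: mult_le_one)
    also have "\<dots> = 1" by (simp add: R.prob_space)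
    finally show False by simp
  qed

  \<comment> \<open>The first-order condition and the normalising constant\<close>
  define g where "g \<omega> = ?w \<omega> * neg_deriv_loss a (?X H \<omega>)" for \<omega>
  have [measurable]: "g \<in> borel_measurable M" unfolding g_def[abs_def] by measurable
  have g_pos: "g \<omega> > 0" for \<omega> unfolding g_def using w(1) neg_deriv_loss_pos[OF a] by simp
  have int_g: "integrable R g"
    unfolding g_def[abs_def] using neg_deriv_loss_growth[OF a]
    by (intro integrable_tame_weight R_prob R_sets \<eta>) auto
  have int_gX: "integrable R (\<lambda>\<omega>. g \<omega> * ?X G \<omega>)" for G
    unfolding g_def by (rule integrable_pricing[OF R_prob R_sets \<eta>(1) a])
  \<comment> \<open>The minimiser is off the faces of the box, so its coordinate \<open>i\<close>
    can move both ways by less than \<open>r - \<bar>H i\<bar>\<close>.\<close>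
  have "(\<integral>\<omega>. g \<omega> * (S1 i \<omega> - S0 i) \<partial>R) = 0" if i: "i \<in> I" for i
    unfolding g_def
  proof (rule pricing_eq_0_of_local_min[OF R_prob R_sets \<eta>(1) a, of i "r - \<bar>H i\<bar>"])
    show "i \<in> {1..d}" using i I by blast
    have "\<bar>H i\<bar> \<noteq> r" using \<open>H \<notin> T\<close> H i by (auto simp: T_def)
    thus "0 < r - \<bar>H i\<bar>" using strategy_boxD(1)[OF H i] by simp
    fix t assume "\<bar>t\<bar> < r - \<bar>H i\<bar>"
    hence "(\<lambda>k. H k + t * (if k = i then 1 else 0)) \<in> strategy_box I r"
      using strategy_boxD[OF H] i by (auto simp: strategy_box_def)
    from min[OF this] show "(\<integral>\<omega>. ?w \<omega> * loss a (?X H \<omega>) \<partial>R) \<le>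
        (\<integral>\<omega>. ?w \<omega> * loss a (?X (\<lambda>k. H k + t * (if k = i then 1 else 0)) \<omega>) \<partial>R)"
      by (simp add: \<phi>_def)
  qed
  \<comment> \<open>By linearity all strategies supported in \<open>I\<close> have weighted mean 0,
    among them the minimiser.\<close>
  hence zero_I: "(\<integral>\<omega>. g \<omega> * ?X G \<omega> \<partial>R) = 0" if "\<forall>i. i \<notin> I \<longrightarrow> G i = 0" for G
    unfolding g_def pricing_linear[OF R_prob R_sets \<eta>(1) a] using that
    by (intro sum.neutral) (auto simp: g_def)

  define Z where "Z = (\<integral>\<omega>. g \<omega> \<partial>R)"
  have "Z \<ge> 0" unfolding Z_def using g_pos by (intro integral_nonneg_AE AE_I2) (auto simp: less_imp_le)
  moreover have "Z \<noteq> 0"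
  proof
    assume "Z = 0"
    hence "AE \<omega> in R. g \<omega> = 0"
      unfolding Z_def using g_pos
      by (subst (asm) integral_nonneg_eq_0_iff_AE[OF int_g]) (auto simp: less_imp_le)
    hence "AE \<omega> in R. False" by eventually_elim (metis g_pos less_irrefl)
    thus False using R.AE_False by blast
  qed
  ultimately have Z_pos: "Z > 0" by simp
  \<comment> \<open>As the minimiser has weighted mean 0, \<open>Z\<close> is the integral of
    \<open>g\<close> times one plus its gain. The shortfall is positive only where this factor is
    negative, so the logistic part alone bounds the integrand, by 1.\<close>
  have Z_le: "Z \<le> 1"
  proof -
    have "\<forall>i. i \<notin> I \<longrightarrow> H i = 0" using strategy_boxD(2)[OF H] by blast
    hence "Z = (\<integral>\<omega>. g \<omega> \<partial>R) + (\<integral>\<omega>. g \<omega> * ?X H \<omega> \<partial>R)" using zero_I by (simp add: Z_def)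
    also have "\<dots> = (\<integral>\<omega>. g \<omega> + g \<omega> * ?X H \<omega> \<partial>R)" using int_g int_gX by simp
    also have "\<dots> \<le> (\<integral>\<omega>. 1 \<partial>R)"
    proof (rule integral_mono)
      fix \<omega>
      define x where "x = ?X H \<omega>"
      have "(1 + x) * neg_deriv_loss a x = (1 + x) * logistic x + 2 * a * ((1 + x) * shortfall x)"
        by (simp add: neg_deriv_loss_def algebra_simps)
      moreover have "(1 + x) * shortfall x \<le> 0"
        by (cases "x \<ge> -1") (auto simp: shortfall_def mult_nonpos_nonneg)
      hence "2 * a * ((1 + x) * shortfall x) \<le> 0" using a
        by (intro mult_nonneg_nonpos[of "2 * a"]) auto
      ultimately have "(1 + x) * neg_deriv_loss a x \<le> 1"
        using logistic_bounds(3)[of x] by linarith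
      hence "?w \<omega> * ((1 + x) * neg_deriv_loss a x) \<le> ?w \<omega> * 1"
        using w(1)[of \<omega>] by (intro mult_left_mono) auto
      thus "g \<omega> + g \<omega> * ?X H \<omega> \<le> 1"
        using w(2)[of \<omega>] by (simp add: g_def x_def algebra_simps)
    qed (use int_g int_gX in auto)
    also have "\<dots> = 1" by (simp add: R.prob_space)
    finally show ?thesis .
  qed

  \<comment> \<open>The martingale measure\<close>
  define Q where "Q = density R (\<lambda>\<omega>. ennreal (g \<omega> / Z))"
  have Q_sets [measurable_cong]: "sets Q = sets M" by (simp add: Q_def R_sets)
  have dens_nn: "AE \<omega> in R. 0 \<le> g \<omega> / Z" using g_pos Z_pos by (auto intro!: AE_I2 simp: less_imp_le)
  have Q_emeasure: "emeasure Q A = ennreal (\<integral>\<omega>. g \<omega> / Z * indicator A \<omega> \<partial>R)" if A: "A \<in> sets M" for A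
  proof -
    have "emeasure Q A = (\<integral>\<^sup>+\<omega>. ennreal (g \<omega> / Z) * indicator A \<omega> \<partial>R)"
      unfolding Q_def using A R_sets by (subst emeasure_density) auto
    also have "\<dots> = (\<integral>\<^sup>+\<omega>. ennreal (g \<omega> / Z * indicator A \<omega>) \<partial>R)"
      by (intro nn_integral_cong) (auto simp: indicator_def)
    also have "\<dots> = ennreal (\<integral>\<omega>. g \<omega> / Z * indicator A \<omega> \<partial>R)"
    proof (rule nn_integral_eq_integral)
      show "integrable R (\<lambda>\<omega>. g \<omega> / Z * indicator A \<omega>)"
        using A R_sets int_g by (intro integrable_real_mult_indicator) auto
    qed (use g_pos Z_pos in \<open>auto intro!: AE_I2 simp: less_imp_le indicator_def\<close>)
    finally show ?thesis .
  qed
  interpret Q: prob_space Q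
  proof
    have "space Q = space M" using Q_sets sets_eq_imp_space_eq by blast
    hence "emeasure Q (space Q) = ennreal (\<integral>\<omega>. g \<omega> / Z * indicator (space M) \<omega> \<partial>R)"
      using Q_emeasure by simp
    also have "(\<integral>\<omega>. g \<omega> / Z * indicator (space M) \<omega> \<partial>R) = (\<integral>\<omega>. g \<omega> / Z \<partial>R)"
      using R_space by (intro Bochner_Integration.integral_cong) auto
    also have "\<dots> = 1" using Z_pos by (simp add: Z_def)
    finally show "emeasure Q (space Q) = 1" by simp
  qed
  have "Q \<in> martingale_measures M \<P> d S0 S1"
    unfolding martingale_measures_def mem_Collect_eq
  proof (intro conjI ballI bexI)
    show "absolutely_continuous R Q"
      unfolding Q_def absolutely_continuous_def
      by (rule absolutely_continuousI_density[unfolded absolutely_continuous_def]) measurable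
    fix j assume j: "j \<in> {1..d}"
    \<comment> \<open>A redundant asset is replicated quasi-surely, hence \<open>R\<close>-almost
      surely, by a strategy supported in \<open>I\<close>, whose weighted mean is 0.\<close>
    obtain G where G: "\<forall>i. i \<notin> I \<longrightarrow> G i = 0" "qs M \<P> (\<lambda>\<omega>. S1 j \<omega> - S0 j = ?X G \<omega>)"
      using span[OF j] by blast
    have [measurable]: "S1 j \<in> borel_measurable M" by (rule measurable_S1[OF j])
    have AE: "AE \<omega> in R. g \<omega> / Z * (S1 j \<omega> - S0 j) = g \<omega> * ?X G \<omega> / Z"
      using qs_imp_AE[OF G(2) R] by eventually_elim simp
    have "integrable R (\<lambda>\<omega>. g \<omega> / Z * (S1 j \<omega> - S0 j))"
      by (subst integrable_cong_AE[OF _ _ AE]) (use int_gX in auto)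
    hence "integrable Q (\<lambda>\<omega>. S1 j \<omega> - S0 j)"
      unfolding Q_def by (subst integrable_density) (use dens_nn in auto)
    moreover have "(\<integral>\<omega>. S1 j \<omega> - S0 j \<partial>Q) = (\<integral>\<omega>. g \<omega> / Z * (S1 j \<omega> - S0 j) \<partial>R)"
      unfolding Q_def by (subst integral_density) (use dens_nn in auto)
    moreover have "\<dots> = (\<integral>\<omega>. g \<omega> * ?X G \<omega> / Z \<partial>R)" by (rule integral_cong_AE[OF _ _ AE]) measurable
    moreover have "\<dots> = 0" using zero_I[OF G(1)] by simp
    ultimately show "gen_expectation Q (\<lambda>\<omega>. S1 j \<omega> - S0 j) = 0"
      by (subst gen_expectation_eq_0_iff) auto
  qed (fact Q.prob_space_axioms Q_sets R)+

  \<comment> \<open>Domination of \<open>P\<close> by the martingale measure\<close>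
  moreover have "measure P A \<le> 4 * (1 + exp (K j + 1)) * measure Q A + 5 * \<epsilon> j"
    if j: "j \<in> J" and A [measurable]: "A \<in> sets M" for j A
  proof -
    \<comment> \<open>On \<open>A1\<close> the density is bounded below: 4 is 2 for passing from
      \<open>P\<close> to \<open>R\<close> times 2 for the weight, and
      \<open>1 + exp (K j + 1)\<close> is the reciprocal of the logistic bound. The error is
      \<open>\<epsilon> j\<close> from small weights on \<open>A2\<close> plus
      \<open>4 * \<epsilon> j\<close> from large gains on \<open>A3\<close>.\<close>
    define A1 where "A1 = {\<omega> \<in> A. 1 / 2 \<le> ?w \<omega> \<and> ?X H \<omega> \<le> K j + 1}"
    define A2 where "A2 = {\<omega> \<in> space M. ?w \<omega> < 1 / 2}"
    define A3 where "A3 = {\<omega> \<in> space M. 1 / 2 \<le> ?w \<omega> \<and> K j + 1 \<le> ?X H \<omega>}"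
    have A_sub: "A \<subseteq> space M" using A sets.sets_into_space by blast
    have "A1 = A \<inter> {\<omega> \<in> space M. 1 / 2 \<le> ?w \<omega> \<and> ?X H \<omega> \<le> K j + 1}"
      using A_sub by (auto simp: A1_def)
    hence A1 [measurable]: "A1 \<in> sets M" by simp
    have A23 [measurable]: "A2 \<in> sets M" "A3 \<in> sets M" unfolding A2_def A3_def by measurable
    have "H \<notin> B j" using \<open>H \<notin> T\<close> H j by (auto simp: T_def)
    hence "measure P A3 \<le> 4 * \<epsilon> j"
      using measure_le_ramp_integral[OF P \<eta>(1), of S0 "K j" H] by (simp add: B_def A3_def)
    moreover have "measure P A2 \<le> \<epsilon> j" using \<eta>(2) e(2)[OF j] by (simp add: A2_def)
    moreover have "measure P A \<le> measure P A1 + measure P A2 + measure P A3"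
    proof -
      have "A \<subseteq> A1 \<union> A2 \<union> A3" using A_sub by (auto simp: A1_def A2_def A3_def)
      hence "measure P A \<le> measure P (A1 \<union> A2 \<union> A3)"
        by (intro P.finite_measure_mono) measurable
      also have "\<dots> \<le> measure P (A1 \<union> A2) + measure P A3"
        by (intro measure_Un_le) measurable
      also have "\<dots> \<le> measure P A1 + measure P A2 + measure P A3"
        by (intro add_right_mono measure_Un_le) measurable
      finally show ?thesis .
    qed
    moreover have "measure P A1 \<le> 2 * measure R A1" by (rule dom[OF A1])
    moreover have "measure R A1 * (1 / 2 * logistic (K j + 1)) \<le> measure Q A"
    proof -
      have "measure R A1 * (1 / 2 * logistic (K j + 1)) =
          (\<integral>\<omega>. 1 / 2 * logistic (K j + 1) * indicator A1 \<omega> \<partial>R)"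
        using A1 A_sub R_space by simp
      also have "\<dots> \<le> (\<integral>\<omega>. g \<omega> / Z * indicator A \<omega> \<partial>R)"
      proof (rule integral_mono)
        show "integrable R (\<lambda>\<omega>. 1 / 2 * logistic (K j + 1) * indicator A1 \<omega>)"
          using A1 R_sets by (intro integrable_mult_right integrable_real_indicator)
            (auto simp: less_top[symmetric])
        show "integrable R (\<lambda>\<omega>. g \<omega> / Z * indicator A \<omega>)"
          using A R_sets int_g by (intro integrable_real_mult_indicator) auto
        fix \<omega>
        show "1 / 2 * logistic (K j + 1) * indicator A1 \<omega> \<le> g \<omega> / Z * indicator A \<omega>"
        proof (cases "\<omega> \<in> A1")
          case True
          hence \<omega>: "\<omega> \<in> A" "1 / 2 \<le> ?w \<omega>" "?X H \<omega> \<le> K j + 1" by (auto simp: A1_def)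
          have "logistic (K j + 1) \<le> neg_deriv_loss a (?X H \<omega>)"
            using logistic_antimono[OF \<omega>(3)] a shortfall_nonneg[of "?X H \<omega>"]
            by (auto simp: neg_deriv_loss_def intro: add_increasing2)
          hence "1 / 2 * logistic (K j + 1) \<le> g \<omega>"
            unfolding g_def using \<omega>(2) logistic_bounds(1)[of "K j + 1"] w(1)[of \<omega>]
            by (intro mult_mono) auto
          also have "\<dots> \<le> g \<omega> / Z" using Z_pos Z_le g_pos[of \<omega>] by (simp add: field_simps)
          finally show ?thesis using True \<omega>(1) by simp
        next
          case False
          thus ?thesis using g_pos[of \<omega>] Z_pos by (simp add: indicator_def)
        qed
      qed
      also have "\<dots> = measure Q A"
      proof -
        have "0 \<le> (\<integral>\<omega>. g \<omega> / Z * indicator A \<omega> \<partial>R)"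
          using g_pos Z_pos by (intro integral_nonneg_AE AE_I2) (auto simp: less_imp_le)
        thus ?thesis by (simp add: measure_def Q_emeasure[OF A])
      qed
      finally show ?thesis .
    qed
    hence "measure R A1 \<le> 2 * (1 + exp (K j + 1)) * measure Q A"
      by (simp add: logistic_def divide_le_eq add_pos_pos mult_ac)
    ultimately show ?thesis by linarith
  qed
  ultimately show ?thesis by blast
qed

text \<open>Markov's inequality for the gain plus \<open>c\<close>, which has mean \<open>c\<close>
  under \<open>Q\<close>. It is nonnegative \<open>Q\<close>-almost surely because \<open>Q\<close>
  is absolutely continuous with respect to some prior.\<close>

lemma martingale_measure_gain_prob_le:
  assumes Q: "Q \<in> martingale_measures M \<P> d S0 S1"
    and qs: "qs M \<P> (\<lambda>\<omega>. gain d S0 S1 H \<omega> \<ge> - c)" and "\<alpha> > 0" "c \<ge> 0"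
  shows "measure Q {\<omega> \<in> space M. gain d S0 S1 H \<omega> \<ge> \<alpha>} \<le> c / \<alpha>"
proof -
  obtain P where "prob_space Q" and Q_sets [measurable_cong]: "sets Q = sets M"
    and P: "P \<in> \<P>" "absolutely_continuous P Q"
    and ge: "\<And>i. i \<in> {1..d} \<Longrightarrow> gen_expectation Q (\<lambda>\<omega>. S1 i \<omega> - S0 i) = 0"
    using Q unfolding martingale_measures_def by blast
  interpret Q: prob_space Q by fact
  let ?X = "gain d S0 S1 H"
  have i: "integrable Q (\<lambda>\<omega>. S1 i \<omega> - S0 i) \<and> (\<integral>\<omega>. S1 i \<omega> - S0 i \<partial>Q) = 0" if i: "i \<in> {1..d}" for i
  proof -
    have [measurable]: "S1 i \<in> borel_measurable M" by (rule measurable_S1[OF i])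
    have "(\<lambda>\<omega>. S1 i \<omega> - S0 i) \<in> borel_measurable Q" by measurable
    from gen_expectation_eq_0_iff[OF this] show ?thesis using ge[OF i] by blast
  qed
  have int: "integrable Q ?X"
    unfolding gain_def[abs_def] using i by (intro Bochner_Integration.integrable_sum integrable_mult_right) auto
  have "(\<integral>\<omega>. ?X \<omega> \<partial>Q) = (\<Sum>i=1..d. \<integral>\<omega>. H i * (S1 i \<omega> - S0 i) \<partial>Q)"
    unfolding gain_def using i by (intro Bochner_Integration.integral_sum integrable_mult_right) auto
  also have "\<dots> = 0" using i by (intro sum.neutral ballI) simp
  finally have mean: "(\<integral>\<omega>. ?X \<omega> \<partial>Q) = 0" .
  have "AE \<omega> in P. ?X \<omega> \<ge> - c" by (rule qs_imp_AE[OF qs P(1)])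
  hence AE: "AE \<omega> in Q. ?X \<omega> \<ge> - c"
    by (intro absolutely_continuous_AE[OF _ P(2)]) (use Q_sets prior[OF P(1)] in auto)
  let ?A = "{\<omega> \<in> space M. ?X \<omega> \<ge> \<alpha>}"
  have A: "?A \<in> sets Q" by measurable
  have "\<alpha> * measure Q ?A = (\<integral>\<omega>. \<alpha> * indicator ?A \<omega> \<partial>Q)"
    using sets.sets_into_space[OF A] by (simp add: Int_absorb2)
  also have "\<dots> \<le> (\<integral>\<omega>. ?X \<omega> + c \<partial>Q)"
  proof (rule integral_mono_AE)
    show "AE \<omega> in Q. \<alpha> * indicator ?A \<omega> \<le> ?X \<omega> + c"
      using AE by eventually_elim (use assms(4) in \<open>auto simp: indicator_def\<close>)
  qed (use int A in \<open>auto simp: less_top[symmetric]\<close>)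
  also have "\<dots> = c" using int mean by (simp add: Q.prob_space)
  finally show ?thesis using assms(3) by (simp add: field_simps)
qed

end

section \<open>Sequences of markets\<close>

lemma qs_mono:
  assumes "qs M \<P> \<phi>" "\<And>\<omega>. \<phi> \<omega> \<Longrightarrow> \<psi> \<omega>"
  shows "qs M \<P> \<psi>"
proof -
  obtain A where "A \<in> sets M" "{\<omega> \<in> space M. \<not> \<phi> \<omega>} \<subseteq> A" "\<forall>P\<in>\<P>. emeasure P A = 0"
    using assms(1) unfolding qs_def polar_def by blast
  with assms(2) show ?thesis unfolding qs_def polar_def by (intro bexI[of _ A]) blast+
qed

text \<open>Otherwise, along ever later markets, gains bounded below by -1 exceed
  \<open>k + 1\<close> with probability above \<epsilon>. Dividing these strategies by
  \<open>k + 1\<close> gives an asymptotic arbitrage.\<close>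

lemma not_AA1_imp_bounded_in_probability:
  fixes M :: "nat \<Rightarrow> 'a measure"
  assumes mkt: "\<And>n. n \<ge> 1 \<Longrightarrow> robust_market (M n) (\<P> n) (d n) (S1 n)"
    and NAA: "\<not> AA1 M \<P> d S0 S1" and P: "\<And>n. n \<ge> 1 \<Longrightarrow> P n \<in> \<P> n" and "\<epsilon> > 0"
  shows "\<exists>K N. \<forall>n\<ge>max 1 N. \<forall>H. qs (M n) (\<P> n) (\<lambda>\<omega>. gain (d n) (S0 n) (S1 n) H \<omega> \<ge> -1) \<longrightarrow>
    measure (P n) {\<omega> \<in> space (M n). K \<le> gain (d n) (S0 n) (S1 n) H \<omega>} \<le> \<epsilon>"
proof (rule ccontr)
  assume "\<not> ?thesis"
  hence ex: "\<exists>n\<ge>max 1 N. \<exists>H. qs (M n) (\<P> n) (\<lambda>\<omega>. gain (d n) (S0 n) (S1 n) H \<omega> \<ge> -1) \<and>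
    measure (P n) {\<omega> \<in> space (M n). K \<le> gain (d n) (S0 n) (S1 n) H \<omega>} > \<epsilon>" for K N
    by (metis not_le)
  define good where "good k n \<longleftrightarrow> n \<ge> 1 \<and> (\<exists>H. qs (M n) (\<P> n) (\<lambda>\<omega>. gain (d n) (S0 n) (S1 n) H \<omega> \<ge> -1) \<and>
    measure (P n) {\<omega> \<in> space (M n). real (Suc k) \<le> gain (d n) (S0 n) (S1 n) H \<omega>} > \<epsilon>)" for k n
  have next_good: "\<exists>m. good k m \<and> n < m" for k n
  proof -
    obtain m where "m \<ge> max 1 (Suc n)"
      "\<exists>H. qs (M m) (\<P> m) (\<lambda>\<omega>. gain (d m) (S0 m) (S1 m) H \<omega> \<ge> -1) \<and>
        measure (P m) {\<omega> \<in> space (M m). real (Suc k) \<le> gain (d m) (S0 m) (S1 m) H \<omega>} > \<epsilon>"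
      using ex[of "Suc n" "real (Suc k)"] by blast
    thus ?thesis unfolding good_def by (intro exI[of _ m]) simp
  qed
  have "\<exists>f. \<forall>k. good k (f k) \<and> f k < f (Suc k)"
    by (rule dependent_nat_choice) (use next_good in blast)+
  then obtain f where f: "\<And>k. good k (f k)" "\<And>k. f k < f (Suc k)" by blast
  have "strict_mono f" using f(2) by (simp add: strict_mono_Suc_iff)
  from f(1) have "\<exists>H. qs (M (f k)) (\<P> (f k)) (\<lambda>\<omega>. gain (d (f k)) (S0 (f k)) (S1 (f k)) H \<omega> \<ge> -1) \<and>
    measure (P (f k)) {\<omega> \<in> space (M (f k)). real (Suc k) \<le> gain (d (f k)) (S0 (f k)) (S1 (f k)) H \<omega>} > \<epsilon>" for k
    unfolding good_def by blast
  then obtain H where H: "\<And>k. qs (M (f k)) (\<P> (f k)) (\<lambda>\<omega>. gain (d (f k)) (S0 (f k)) (S1 (f k)) (H k) \<omega> \<ge> -1)"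
    "\<And>k. measure (P (f k)) {\<omega> \<in> space (M (f k)). real (Suc k) \<le> gain (d (f k)) (S0 (f k)) (S1 (f k)) (H k) \<omega>} > \<epsilon>"
    by metis
  \<comment> \<open>Both the scaling factor of the strategies and the vanishing bound on their
    losses.\<close>
  define c where "c k = 1 / real (Suc k)" for k
  \<comment> \<open>One number has to bound both the scaled gain, which reaches 1, and its
    probability, which exceeds \<epsilon>.\<close>
  define \<alpha> where "\<alpha> = min 1 \<epsilon>"
  have "AA1 M \<P> d S0 S1"
    unfolding AA1_def
  proof (intro exI[of _ f] exI[of _ "\<lambda>k i. c k * H k i"] exI[of _ c] conjI allI impI exI[of _ \<alpha>]
      exI[of _ "\<lambda>k. P (f k)"])
    show "strict_mono_on {1..} f" using \<open>strict_mono f\<close> by (auto simp: strict_mono_on_def strict_mono_def)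
    show "c \<longlonglongrightarrow> 0" unfolding c_def by (rule lim_1_over_n[THEN LIMSEQ_Suc])
    show "\<alpha> > 0" using \<open>\<epsilon> > 0\<close> by (simp add: \<alpha>_def)
    fix k :: nat
    have c: "c k > 0" by (simp add: c_def)
    thus "c k > 0" .
    show f1: "1 \<le> f k" using f(1) by (simp add: good_def)
    show "P (f k) \<in> \<P> (f k)" by (rule P[OF f1])
    interpret robust_market "M (f k)" "\<P> (f k)" "d (f k)" "S1 (f k)" by (rule mkt[OF f1])
    interpret Pk: prob_space "P (f k)" using prior P[OF f1] by blast
    have [measurable_cong]: "sets (P (f k)) = sets (M (f k))" using prior P[OF f1] by blast
    show "qs (M (f k)) (\<P> (f k)) (\<lambda>\<omega>. - c k \<le> gain (d (f k)) (S0 (f k)) (S1 (f k)) (\<lambda>i. c k * H k i) \<omega>)"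
    proof (rule qs_mono[OF H(1)[of k]])
      fix \<omega> assume "-1 \<le> gain (d (f k)) (S0 (f k)) (S1 (f k)) (H k) \<omega>"
      hence "c k * -1 \<le> c k * gain (d (f k)) (S0 (f k)) (S1 (f k)) (H k) \<omega>"
        using c by (intro mult_left_mono) auto
      thus "- c k \<le> gain (d (f k)) (S0 (f k)) (S1 (f k)) (\<lambda>i. c k * H k i) \<omega>"
        by (simp add: gain_scale)
    qed
    have "\<epsilon> \<le> measure (P (f k)) {\<omega> \<in> space (M (f k)). real (Suc k) \<le> gain (d (f k)) (S0 (f k)) (S1 (f k)) (H k) \<omega>}"
      using H(2)[of k] by simp
    also have "\<dots> \<le> measure (P (f k)) {\<omega> \<in> space (M (f k)).
        \<alpha> \<le> gain (d (f k)) (S0 (f k)) (S1 (f k)) (\<lambda>i. c k * H k i) \<omega>}"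
    proof (rule Pk.finite_measure_mono)
      show "{\<omega> \<in> space (M (f k)). real (Suc k) \<le> gain (d (f k)) (S0 (f k)) (S1 (f k)) (H k) \<omega>}
        \<subseteq> {\<omega> \<in> space (M (f k)). \<alpha> \<le> gain (d (f k)) (S0 (f k)) (S1 (f k)) (\<lambda>i. c k * H k i) \<omega>}"
      proof safe
        fix \<omega> assume "real (Suc k) \<le> gain (d (f k)) (S0 (f k)) (S1 (f k)) (H k) \<omega>"
        hence "1 \<le> c k * gain (d (f k)) (S0 (f k)) (S1 (f k)) (H k) \<omega>"
          by (simp add: c_def field_simps)
        thus "\<alpha> \<le> gain (d (f k)) (S0 (f k)) (S1 (f k)) (\<lambda>i. c k * H k i) \<omega>"
          by (simp add: gain_scale \<alpha>_def)
      qed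
    qed measurable
    finally show "\<alpha> \<le> measure (P (f k)) {\<omega> \<in> space (M (f k)).
        \<alpha> \<le> gain (d (f k)) (S0 (f k)) (S1 (f k)) (\<lambda>i. c k * H k i) \<omega>}"
      by (simp add: \<alpha>_def)
  qed
  with NAA show False by contradiction
qed

text \<open>For a fixed sequence of sets the first term tends to 0, whatever \<open>C\<close> is,
  and the error \<open>e\<close> is arbitrary. So \<open>C\<close> and the stage from which the
  bound holds may depend on \<open>e\<close>.\<close>

lemma contiguousI:
  assumes dom: "\<And>e. e > 0 \<Longrightarrow> \<exists>C. \<forall>\<^sub>F n in sequentially. \<forall>A\<in>sets (M n).
      measure (P n) A \<le> C * measure (Q n) A + e"
  shows "contiguous M P Q"
  unfolding contiguous_def
proof (intro allI impI)
  fix A assume A: "\<forall>n\<ge>1. A n \<in> sets (M n)" and lim: "(\<lambda>n. measure (Q n) (A n)) \<longlonglongrightarrow> 0"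
  show "(\<lambda>n. measure (P n) (A n)) \<longlonglongrightarrow> 0"
  proof (rule tendstoI)
    fix e :: real assume "e > 0"
    then obtain C where C: "\<forall>\<^sub>F n in sequentially. \<forall>A\<in>sets (M n). measure (P n) A \<le> C * measure (Q n) A + e / 2"
      using dom[of "e / 2"] by auto
    have "(\<lambda>n. C * measure (Q n) (A n)) \<longlonglongrightarrow> C * 0" by (intro tendsto_intros lim)
    hence "\<forall>\<^sub>F n in sequentially. C * measure (Q n) (A n) < e / 2"
      using \<open>e > 0\<close> by (intro order_tendstoD) auto
    moreover have "\<forall>\<^sub>F n in sequentially. A n \<in> sets (M n)"
      using A by (auto simp: eventually_sequentially)
    ultimately show "\<forall>\<^sub>F n in sequentially. dist (measure (P n) (A n)) 0 < e"
      using C by eventually_elim (fastforce simp: dist_real_def)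
  qed
qed

text \<open>The priors of the arbitrage, completed to a full sequence, are the witness: on the
  events of gain at least \<alpha> they keep mass \<alpha>, while martingale measures give these
  events at most \<open>c k / \<alpha>\<close>.\<close>

lemma AA1_imp_not_contiguous:
  fixes M :: "nat \<Rightarrow> 'a measure"
  assumes mkt: "\<And>n. n \<ge> 1 \<Longrightarrow> robust_market (M n) (\<P> n) (d n) (S1 n)" and AA1: "AA1 M \<P> d S0 S1"
  shows "\<exists>P. (\<forall>n\<ge>1. P n \<in> \<P> n) \<and>
    (\<forall>Q. (\<forall>n\<ge>1. Q n \<in> martingale_measures (M n) (\<P> n) (d n) (S0 n) (S1 n)) \<longrightarrow> \<not> contiguous M P Q)"
proof -
  obtain f H c \<alpha> P where f: "strict_mono_on {1..} f" "\<And>k. k \<ge> 1 \<Longrightarrow> f k \<ge> 1"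
    and c: "\<And>k. k \<ge> 1 \<Longrightarrow> c k > 0" "c \<longlonglongrightarrow> (0 :: real)"
    and X: "\<And>k. k \<ge> 1 \<Longrightarrow> qs (M (f k)) (\<P> (f k))
          (\<lambda>\<omega>. gain (d (f k)) (S0 (f k)) (S1 (f k)) (H k) \<omega> \<ge> - c k)"
    and \<alpha>: "\<alpha> > 0" and P: "\<And>k. k \<ge> 1 \<Longrightarrow> P k \<in> \<P> (f k)"
      "\<And>k. k \<ge> 1 \<Longrightarrow> measure (P k) {\<omega> \<in> space (M (f k)).
            gain (d (f k)) (S0 (f k)) (S1 (f k)) (H k) \<omega> \<ge> \<alpha>} \<ge> \<alpha>"
    using AA1 unfolding AA1_def by blast
  have inj: "inj_on f {1..}" by (rule strict_mono_on_imp_inj_on[OF f(1)])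
  define g where "g n = the_inv_into {1..} f n" for n
  have g: "g (f k) = k" if "k \<ge> 1" for k
    unfolding g_def using that by (intro the_inv_into_f_f[OF inj]) auto
  \<comment> \<open>Off the subsequence any prior will do, and the test sets \<open>A n\<close> are
    empty there, so that their probabilities under \<open>Q n\<close> still tend to 0.\<close>
  define P' where "P' n = (if n \<in> f ` {1..} then P (g n) else (SOME p. p \<in> \<P> n))" for n
  define A where "A n = (if n \<in> f ` {1..} then {\<omega> \<in> space (M n).
            gain (d n) (S0 n) (S1 n) (H (g n)) \<omega> \<ge> \<alpha>} else {})" for n
  have P'_in: "P' n \<in> \<P> n" if n: "n \<ge> 1" for n
  proof (cases "n \<in> f ` {1..}")
    case True
    thus ?thesis using g P(1) by (auto simp: P'_def)
  next
    case False
    interpret robust_market "M n" "\<P> n" "d n" "S1 n" by (rule mkt[OF n])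
    show ?thesis using nonempty False by (simp add: P'_def some_in_eq)
  qed
  have "\<not> contiguous M P' Q"
    if Q: "\<And>n. n \<ge> 1 \<Longrightarrow> Q n \<in> martingale_measures (M n) (\<P> n) (d n) (S0 n) (S1 n)" for Q
  proof
    assume "contiguous M P' Q"
    have "A n \<in> sets (M n)" if n: "n \<ge> 1" for n
    proof -
      interpret robust_market "M n" "\<P> n" "d n" "S1 n" by (rule mkt[OF n])
      show ?thesis by (simp add: A_def)
    qed
    moreover have "(\<lambda>n. measure (Q n) (A n)) \<longlonglongrightarrow> 0"
    proof (rule tendstoI)
      fix e :: real assume "e > 0"
      hence "\<forall>\<^sub>F k in sequentially. c k < \<alpha> * e" using c(2) \<alpha> by (intro order_tendstoD) auto
      then obtain k0 where k0: "\<And>k. k \<ge> k0 \<Longrightarrow> c k < \<alpha> * e" by (auto simp: eventually_sequentially)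
      have "dist (measure (Q n) (A n)) 0 < e" if n: "n \<ge> f (max 1 k0)" for n
      proof (cases "n \<in> f ` {1..}")
        case False
        thus ?thesis using \<open>e > 0\<close> by (simp add: A_def)
      next
        case True
        then obtain k where k: "k \<ge> 1" "n = f k" by auto
        \<comment> \<open>Strict monotonicity of \<open>f\<close> turns a late market into a late
          index of the subsequence.\<close>
        have "k \<ge> max 1 k0"
        proof (rule ccontr)
          assume "\<not> k \<ge> max 1 k0"
          hence "f k < f (max 1 k0)" using strict_mono_onD[OF f(1), of k "max 1 k0"] k(1) by auto
          thus False using n k by simp
        qed
        interpret robust_market "M (f k)" "\<P> (f k)" "d (f k)" "S1 (f k)" by (rule mkt[OF f(2)[OF k(1)]])
        have "measure (Q n) (A n) \<le> c k / \<alpha>"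
          using martingale_measure_gain_prob_le[OF Q[OF f(2)[OF k(1)]] X[OF k(1)] \<alpha>] c(1)[OF k(1)] k g
          by (simp add: A_def)
        also have "\<dots> < e" using k0[of k] \<open>k \<ge> max 1 k0\<close> \<alpha> by (simp add: field_simps)
        finally show ?thesis by (simp add: dist_real_def)
      qed
      thus "\<forall>\<^sub>F n in sequentially. dist (measure (Q n) (A n)) 0 < e" by (auto simp: eventually_sequentially)
    qed
    ultimately have "(\<lambda>n. measure (P' n) (A n)) \<longlonglongrightarrow> 0"
      using \<open>contiguous M P' Q\<close> unfolding contiguous_def by blast
    hence "\<forall>\<^sub>F n in sequentially. measure (P' n) (A n) < \<alpha>" using \<alpha> by (rule order_tendstoD)
    then obtain n0 where n0: "\<And>n. n \<ge> n0 \<Longrightarrow> measure (P' n) (A n) < \<alpha>"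
      by (auto simp: eventually_sequentially)
    \<comment> \<open>The shift is due to \<open>f\<close> being increasing only from index 1
      on.\<close>
    have "strict_mono (\<lambda>k. f (Suc k))" using f(1) by (auto simp: strict_mono_on_def strict_mono_def)
    hence "n0 \<le> f (Suc n0)" by (rule strict_mono_imp_increasing)
    hence "measure (P' (f (Suc n0))) (A (f (Suc n0))) < \<alpha>" by (rule n0)
    thus False using P(2)[of "Suc n0"] g[of "Suc n0"] by (simp add: P'_def A_def split: if_splits)
  qed
  with P'_in show ?thesis by blast
qed

theorem theorem4p12:
  fixes M :: "nat \<Rightarrow> 'a measure" and \<P> :: "nat \<Rightarrow> 'a measure set" and d :: "nat \<Rightarrow> nat"
    and S0 :: "nat \<Rightarrow> nat \<Rightarrow> real" and S1 :: "nat \<Rightarrow> nat \<Rightarrow> 'a \<Rightarrow> real"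
  assumes "\<And>n. n \<ge> 1 \<Longrightarrow> robust_market (M n) (\<P> n) (d n) (S1 n)"
    and "\<And>n. n \<ge> 1 \<Longrightarrow> l_map (M n) (\<P> n) ` Linfty (M n) (\<P> n) = E_dual (M n) (\<P> n)"
    and "\<And>n. n \<ge> 1 \<Longrightarrow> NA (M n) (\<P> n) (d n) (S0 n) (S1 n)"
  shows "NAA1 M \<P> d S0 S1 \<longleftrightarrow>
    (\<forall>P. (\<forall>n\<ge>1. P n \<in> \<P> n) \<longrightarrow>
      (\<exists>Q. (\<forall>n\<ge>1. Q n \<in> martingale_measures (M n) (\<P> n) (d n) (S0 n) (S1 n)) \<and>
           contiguous M P Q))"
proof
  assume "\<forall>P. (\<forall>n\<ge>1. P n \<in> \<P> n) \<longrightarrow>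
      (\<exists>Q. (\<forall>n\<ge>1. Q n \<in> martingale_measures (M n) (\<P> n) (d n) (S0 n) (S1 n)) \<and> contiguous M P Q)"
  thus "NAA1 M \<P> d S0 S1" unfolding NAA1_def
    using AA1_imp_not_contiguous[where M = M and \<P> = \<P> and d = d and ?S0.0 = S0 and ?S1.0 = S1, OF assms(1)]
    by blast
next
  assume "NAA1 M \<P> d S0 S1"
  hence NAA: "\<not> AA1 M \<P> d S0 S1" by (simp add: NAA1_def)
  show "\<forall>P. (\<forall>n\<ge>1. P n \<in> \<P> n) \<longrightarrow>
      (\<exists>Q. (\<forall>n\<ge>1. Q n \<in> martingale_measures (M n) (\<P> n) (d n) (S0 n) (S1 n)) \<and> contiguous M P Q)"
  proof (intro allI impI)
    fix P assume "\<forall>n\<ge>1. P n \<in> \<P> n"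
    hence P: "\<And>n. n \<ge> 1 \<Longrightarrow> P n \<in> \<P> n" by blast
    define \<epsilon> where "\<epsilon> j = 1 / real (Suc j)" for j
    have \<epsilon>: "\<epsilon> j > 0" for j by (simp add: \<epsilon>_def)
    obtain K N where KN: "\<And>j n H. n \<ge> max 1 (N j) \<Longrightarrow>
        qs (M n) (\<P> n) (\<lambda>\<omega>. gain (d n) (S0 n) (S1 n) H \<omega> \<ge> -1) \<Longrightarrow>
        measure (P n) {\<omega> \<in> space (M n). K j \<le> gain (d n) (S0 n) (S1 n) H \<omega>} \<le> \<epsilon> j"
      using not_AA1_imp_bounded_in_probability[where M = M and \<P> = \<P> and d = d and ?S0.0 = S0 and ?S1.0 = S1
          and P = P, OF assms(1) NAA P \<epsilon>] by metis
    \<comment> \<open>One \<open>Q n\<close> has to serve all tolerances \<open>\<epsilon> j\<close> that are available at stage \<open>n\<close>.\<close>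
    define J where "J n = {j. j < n \<and> N j \<le> n}" for n
    have "\<exists>Q\<in>martingale_measures (M n) (\<P> n) (d n) (S0 n) (S1 n). \<forall>j\<in>J n. \<forall>A\<in>sets (M n).
        measure (P n) A \<le> 4 * (1 + exp (K j + 1)) * measure Q A + 5 * \<epsilon> j" if n: "n \<ge> 1" for n
    proof -
      interpret robust_market "M n" "\<P> n" "d n" "S1 n" by (rule assms(1)[OF n])
      \<comment> \<open>The condition \<open>j < n\<close> keeps \<open>J n\<close> finite, and
        \<open>N j \<le> n\<close> makes the bound for tolerance \<open>j\<close> available.\<close>
      show ?thesis
        using n KN by (intro exists_martingale_measure assms(3)[OF n] P[OF n] \<epsilon>) (auto simp: J_def)
    qed
    then obtain Q where Q: "\<And>n. n \<ge> 1 \<Longrightarrow> Q n \<in> martingale_measures (M n) (\<P> n) (d n) (S0 n) (S1 n)"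
      "\<And>n j A. n \<ge> 1 \<Longrightarrow> j \<in> J n \<Longrightarrow> A \<in> sets (M n) \<Longrightarrow>
        measure (P n) A \<le> 4 * (1 + exp (K j + 1)) * measure (Q n) A + 5 * \<epsilon> j"
      by metis
    have "contiguous M P Q"
    proof (rule contiguousI)
      fix e :: real assume "e > 0"
      \<comment> \<open>The total error for this tolerance is \<open>5 * \<epsilon> j\<close>, hence
        the fifth of \<open>e\<close>.\<close>
      then obtain j where j: "inverse (real (Suc j)) < e / 5" using reals_Archimedean[of "e / 5"] by auto
      \<comment> \<open>From this stage on \<open>j\<close> belongs to \<open>J n\<close>, and the
        constant no longer changes with \<open>n\<close>.\<close>
      have "measure (P n) A \<le> 4 * (1 + exp (K j + 1)) * measure (Q n) A + e"
        if "n \<ge> max (Suc j) (N j)" "A \<in> sets (M n)" for n A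
        using Q(2)[of n j A] that j by (simp add: J_def \<epsilon>_def inverse_eq_divide)
      thus "\<exists>C. \<forall>\<^sub>F n in sequentially. \<forall>A\<in>sets (M n). measure (P n) A \<le> C * measure (Q n) A + e"
        unfolding eventually_sequentially by blast
    qed
    with Q(1) show "\<exists>Q. (\<forall>n\<ge>1. Q n \<in> martingale_measures (M n) (\<P> n) (d n) (S0 n) (S1 n)) \<and>
        contiguous M P Q" by blast
  qed
qed

end
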